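(* Let $R$ be a factorial domain, $K$ a field of quotients of $R$, $X$ an indeterminate over $K$, $\mathcal{P}$ a system of representatives of $\mathcal{A}(R)$, $n\in\mathbb{N}$, $\underline{a}=(a_i)_{i=1}^n\in R^n$, and $\underline{p}=(p_i)_{i=1}^n\in\mathcal{P}^n$ such that for all $i\in[1,n]$: $p_1\mid_R a_i-1$; $a_i+p_kR\in(R/p_kR)^{\times}$ for all $k\in[2,n]$; and if $i>1$, then $n=|\{p_j+p_1R\mid j\in[1,n]\}|=|R/p_1R|<|R/p_iR|$. Set $H=[\![\prod_{i=1}^n(a_iX-p_i)]\!]$. Then $\mathcal{C}_v(H)\cong\mathbb{Z}^{n-1}$, for every $P\in\mathfrak{X}(H)$ there is some $Q\in\mathfrak{X}(H)$ such that $(PQ)_v$ is a principal ideal of $H$, and ${\rm D}(\{[P]\mid P\in\mathfrak{X}(H)\})\geq n$.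
   Context: $\mathcal{A}(R)$ is the set of atoms (prime elements) of $R$; a system of representatives of $\mathcal{A}(R)$ contains exactly one element from each class of associated atoms. $[1,n]$ and $[2,n]$ are integer intervals; $x\mid_R y$ means $x$ divides $y$ in $R$. Monoids are commutative and cancellative; $D^{\bullet}=D\setminus\{0\}$ for a domain $D$. ${\rm Int}(R)=\{h\in K[X]\mid h(c)\in R\text{ for all }c\in R\}$. For $f\in{\rm Int}(R)^{\bullet}$, $[\![f]\!]=\{h\in{\rm Int}(R)^{\bullet}\mid h\text{ divides }f^k\text{ in }{\rm Int}(R)\text{ for some }k\in\mathbb{N}_0\}$; it is known that $[\![f]\!]$ is a Krull monoid. For a monoid $H$ with quotient group $L$: an $s$-ideal is a subset $I\subseteq H$ with $IH=I$ (the empty set is allowed); it is prime if $I\neq H$ and $H\setminus I$ is a submonoid. $\mathfrak{X}(H)$ is the set of minimal nonempty prime $s$-ideals of $H$. For $Y\subseteq L$ put $Y^{-1}=\{z\in L\mid zY\subseteq H\}$ and $Y_v=(Y^{-1})^{-1}$. For a Krull monoid $H$, the divisor-class group $\mathcal{C}_v(H)$ is the group of nonempty fractional $v$-ideals of $H$ under $(I,J)\mapsto(IJ)_v$ modulo principal fractional ideals; $[I]$ is the class of $I$. For a subset $G_0$ of an abelian group $G$ (written additively), the Davenport constant ${\rm D}(G_0)$ is the supremum of the lengths of nonempty minimal zero-sum sequences over $G_0$, i.e. finite unordered sequences (repetition allowed) of elements of $G_0$ with sum $0$ such that no nonempty proper subsequence has sum $0$. *)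

theory Defs
  imports
    "HOL-Computational_Algebra.Computational_Algebra"
    "HOL-Library.Set_Algebras"
    "HOL-Library.Equipollence"
    "HOL-Library.Extended_Nat"
    "HOL-Algebra.Product_Groups"
    "HOL-Algebra.QuotRing"
    "HOL-Algebra.Algebraic_Closure_Type"
begin

section \<open>Factorial domains, quotient fields and integer-valued polynomials\<close>

text \<open>A field of quotients of a domain is given by an embedding; the domain is not assumed to be
  literally a subset of the field.\<close>

definition quotient_field :: "('r::idom \<Rightarrow> 'k::field) \<Rightarrow> bool" where
  "quotient_field \<iota> \<longleftrightarrow>
     \<iota> 1 = 1 \<and> (\<forall>x y. \<iota> (x + y) = \<iota> x + \<iota> y) \<and> (\<forall>x y. \<iota> (x * y) = \<iota> x * \<iota> y) \<and>
     inj \<iota> \<and> (\<forall>z. \<exists>x y. y \<noteq> 0 \<and> z = \<iota> x / \<iota> y)"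

definition atom_representatives :: "'r::comm_semiring_1 set \<Rightarrow> bool" where
  "atom_representatives \<P> \<longleftrightarrow>
     (\<forall>p\<in>\<P>. prime_elem p) \<and> (\<forall>q. prime_elem q \<longrightarrow> (\<exists>!p. p \<in> \<P> \<and> p dvd q \<and> q dvd p))"

abbreviation residue_ring_mod :: "'r::comm_ring_1 \<Rightarrow> 'r set ring" where
  "residue_ring_mod p \<equiv> ring_of_type_algebra Quot (PIdl\<^bsub>ring_of_type_algebra\<^esub> p)"

abbreviation residue_class :: "'r::comm_ring_1 \<Rightarrow> 'r \<Rightarrow> 'r set" where
  "residue_class p x \<equiv> (PIdl\<^bsub>ring_of_type_algebra\<^esub> p) +>\<^bsub>ring_of_type_algebra\<^esub> x"

definition Int_poly :: "('r::idom \<Rightarrow> 'k::field) \<Rightarrow> 'k poly set" where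
  "Int_poly \<iota> = {h. \<forall>c. poly h (\<iota> c) \<in> range \<iota>}"

definition divisors_of_powers :: "('r::idom \<Rightarrow> 'k::field) \<Rightarrow> 'k poly \<Rightarrow> 'k poly set" where
  "divisors_of_powers \<iota> f =
     {h \<in> Int_poly \<iota>. h \<noteq> 0 \<and> (\<exists>k::nat. \<exists>g\<in>Int_poly \<iota>. f ^ k = h * g)}"


section \<open>Ideal theory of monoids\<close>

text \<open>A monoid is a multiplicative submonoid \<open>H\<close> of the nonzero elements of some field, so that its
  quotient group is available as a set of fractions. A set of polynomials \<open>f\<close> is viewed in the field
  of rational functions via \<open>to_fract\<close>. Products of sets and the translates \<open>z *o I\<close> are those of
  Set_Algebras.\<close>

definition quot_group :: "'f::field set \<Rightarrow> 'f set" where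
  "quot_group H = {x / y | x y. x \<in> H \<and> y \<in> H}"

definition s_ideal :: "'f::field set \<Rightarrow> 'f set \<Rightarrow> bool" where
  "s_ideal H I \<longleftrightarrow> I \<subseteq> H \<and> I * H = I"

definition prime_s_ideal :: "'f::field set \<Rightarrow> 'f set \<Rightarrow> bool" where
  "prime_s_ideal H P \<longleftrightarrow> s_ideal H P \<and> P \<noteq> H \<and>
     1 \<in> H - P \<and> (\<forall>x\<in>H - P. \<forall>y\<in>H - P. x * y \<in> H - P)"

definition min_primes :: "'f::field set \<Rightarrow> 'f set set" where
  "min_primes H = {P. prime_s_ideal H P \<and> P \<noteq> {} \<and>
     (\<forall>Q. prime_s_ideal H Q \<and> Q \<noteq> {} \<and> Q \<subseteq> P \<longrightarrow> Q = P)}"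

definition inv_set :: "'f::field set \<Rightarrow> 'f set \<Rightarrow> 'f set" where
  "inv_set H Y = {z \<in> quot_group H. z *o Y \<subseteq> H}"

definition v_closure :: "'f::field set \<Rightarrow> 'f set \<Rightarrow> 'f set" where
  "v_closure H Y = inv_set H (inv_set H Y)"

definition frac_v_ideals :: "'f::field set \<Rightarrow> 'f set set" where
  "frac_v_ideals H = {I. I \<noteq> {} \<and> I \<subseteq> quot_group H \<and> I * H = I \<and> (\<exists>c\<in>H. c *o I \<subseteq> H) \<and>
     v_closure H I = I}"

definition principal_frac_ideals :: "'f::field set \<Rightarrow> 'f set set" where
  "principal_frac_ideals H = {z *o H | z. z \<in> quot_group H}"

definition v_ideal_monoid :: "'f::field set \<Rightarrow> 'f set monoid" where
  "v_ideal_monoid H = \<lparr>carrier = frac_v_ideals H, monoid.mult = (\<lambda>I J. v_closure H (I * J)), one = H\<rparr>"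

definition v_class_group :: "'f::field set \<Rightarrow> 'f set set monoid" where
  "v_class_group H = v_ideal_monoid H Mod principal_frac_ideals H"

definition ideal_class :: "'f::field set \<Rightarrow> 'f set \<Rightarrow> 'f set set" where
  "ideal_class H I = principal_frac_ideals H #>\<^bsub>v_ideal_monoid H\<^esub> I"


section \<open>Davenport constant\<close>

text \<open>Abelian groups are written multiplicatively here; unordered sequences are multisets.\<close>

definition seq_sum :: "('g, 'b) monoid_scheme \<Rightarrow> 'g multiset \<Rightarrow> 'g" where
  "seq_sum G S = finprod G (\<lambda>g. g [^]\<^bsub>G\<^esub> count S g) (set_mset S)"

definition minimal_zero_sum :: "('g, 'b) monoid_scheme \<Rightarrow> 'g multiset \<Rightarrow> bool" where
  "minimal_zero_sum G S \<longleftrightarrow> S \<noteq> {#} \<and> seq_sum G S = \<one>\<^bsub>G\<^esub> \<and>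
     (\<forall>T. T \<noteq> {#} \<and> T \<subset># S \<longrightarrow> seq_sum G T \<noteq> \<one>\<^bsub>G\<^esub>)"

definition davenport :: "('g, 'b) monoid_scheme \<Rightarrow> 'g set \<Rightarrow> enat" where
  "davenport G G0 = (SUP S \<in> {S. set_mset S \<subseteq> G0 \<and> minimal_zero_sum G S}. enat (size S))"

end

theory Submission
  imports Defs
begin

text \<open>The value of \<open>a\<^sub>i X - p\<^sub>i\<close> at \<open>c\<close> is divisible by \<open>p\<^sub>1\<close> exactly when \<open>c \<equiv> p\<^sub>i\<close> modulo \<open>p\<^sub>1\<close>, so for
  \<open>n \<ge> 2\<close> exactly one factor of the product is divisible by \<open>p\<^sub>1\<close> at each \<open>c\<close>. No other prime divides all
  values: a prime not associated with any \<open>p\<^sub>k\<close> does not divide the value at \<open>0\<close>, and modulo \<open>p\<^sub>k\<close> with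
  \<open>k \<ge> 2\<close> the product has at most \<open>n < |R/p\<^sub>kR|\<close> roots. Hence \<open>H\<close> consists of the elements
  \<open>u p\<^sub>1\<^sup>j \<Prod>(a\<^sub>i X - p\<^sub>i)\<^bsup>e\<^sub>i\<^esup>\<close> with \<open>u\<close> a unit, \<open>e\<^sub>i \<ge> 0\<close> and \<open>e\<^sub>i + j \<ge> 0\<close> for all \<open>i\<close>. These \<open>2n\<close> linear forms
  are independent valuations defining \<open>H\<close>, so the divisor class group is \<open>\<int>\<^bsup>2n\<^esup>\<close> modulo the image of
  \<open>\<int>\<^bsup>n+1\<^esup>\<close>. The primes for \<open>e\<^sub>i\<close> and \<open>e\<^sub>i + j\<close> have opposite classes, and the \<open>n\<close> primes for the \<open>e\<^sub>i\<close>
  form a minimal zero-sum sequence. For \<open>n = 1\<close> there is no fixed prime divisor and \<open>H\<close> is factorial.\<close>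

subsection \<open>Quotient groups in a field\<close>

locale cancellative_submonoid =
  fixes H :: "'f::field set"
  assumes zero_notin: "0 \<notin> H"
    and one_mem: "1 \<in> H"
    and mult_mem: "x \<in> H \<Longrightarrow> y \<in> H \<Longrightarrow> x * y \<in> H"
begin

lemma quot_group_nonzero: "z \<in> quot_group H \<Longrightarrow> z \<noteq> 0"
  using zero_notin by (auto simp: quot_group_def)

lemma subset_quot_group: "H \<subseteq> quot_group H"
  using one_mem by (force simp: quot_group_def)

lemma one_quot_group: "1 \<in> quot_group H"
  using subset_quot_group one_mem by blast

lemma quot_group_mult:
  assumes "x \<in> quot_group H" "y \<in> quot_group H"
  shows "x * y \<in> quot_group H"
proof -
  obtain a b c d where "x = a / b" "y = c / d" "a \<in> H" "b \<in> H" "c \<in> H" "d \<in> H"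
    using assms by (auto simp: quot_group_def)
  then have "x * y = (a * c) / (b * d)" "a * c \<in> H" "b * d \<in> H"
    by (auto simp: mult_mem)
  then show ?thesis
    unfolding quot_group_def by blast
qed

lemma quot_group_inverse: "x \<in> quot_group H \<Longrightarrow> inverse x \<in> quot_group H"
  by (force simp: quot_group_def)

lemma quot_group_power: "x \<in> quot_group H \<Longrightarrow> x ^ k \<in> quot_group H"
  by (induction k) (auto simp: one_quot_group quot_group_mult)

lemma quot_group_power_int: "x \<in> quot_group H \<Longrightarrow> x powi k \<in> quot_group H"
  by (simp add: power_int_def quot_group_power quot_group_inverse)

end

subsection \<open>Monoids defined by finitely many independent valuations\<close>

text \<open>Together, \<open>independent\<close> and \<open>normalized\<close> say that every integer vector is the componentwise
  minimum of value vectors, so the \<open>w i\<close> form a divisor theory.\<close>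

locale finite_krull = cancellative_submonoid H
  for H :: "'f::field set" +
  fixes I :: "'i set" and w :: "'i \<Rightarrow> 'f \<Rightarrow> int"
  assumes finite_I: "finite I"
    and w_mult: "\<lbrakk>i \<in> I; x \<in> quot_group H; y \<in> quot_group H\<rbrakk> \<Longrightarrow> w i (x * y) = w i x + w i y"
    and mem_iff: "z \<in> quot_group H \<Longrightarrow> z \<in> H \<longleftrightarrow> (\<forall>i\<in>I. 0 \<le> w i z)"
    and normalized: "i \<in> I \<Longrightarrow> \<exists>z\<in>quot_group H. w i z = 1"
    and independent: "i \<in> I \<Longrightarrow> \<exists>t\<in>quot_group H. w i t = 0 \<and> (\<forall>k\<in>I - {i}. 0 < w k t)"
begin

section \<open>Fractional ideals described by lower bounds on values\<close>

abbreviation "L \<equiv> quot_group H"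

text \<open>The bounds may be negative, so this is a fractional ideal. Only the values of
  \<open>m\<close> on \<open>I\<close> matter, so different functions can give the same
  ideal.\<close>

definition idl :: "('i \<Rightarrow> int) \<Rightarrow> 'f set" where
  "idl m = {z \<in> L. \<forall>i\<in>I. m i \<le> w i z}"

lemma w_one: "i \<in> I \<Longrightarrow> w i 1 = 0"
  using w_mult[of i 1 1] one_quot_group by simp

lemma w_inverse: "i \<in> I \<Longrightarrow> x \<in> L \<Longrightarrow> w i (inverse x) = - w i x"
  using w_mult[of i x "inverse x"] w_one[of i] quot_group_inverse[of x] quot_group_nonzero[of x]
  by simp

lemma w_power: "i \<in> I \<Longrightarrow> x \<in> L \<Longrightarrow> w i (x ^ k) = int k * w i x"
  by (induction k) (auto simp: w_one w_mult quot_group_power algebra_simps)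

lemma w_power_int: "i \<in> I \<Longrightarrow> x \<in> L \<Longrightarrow> w i (x powi k) = k * w i x"
  by (simp add: power_int_def w_power w_inverse quot_group_inverse)

lemma quot_group_prod: "(\<And>b. b \<in> B \<Longrightarrow> f b \<in> L) \<Longrightarrow> prod f B \<in> L"
  by (induction B rule: infinite_finite_induct) (auto simp: one_quot_group quot_group_mult)

lemma w_prod:
  assumes "i \<in> I" "\<And>b. b \<in> B \<Longrightarrow> f b \<in> L"
  shows "w i (prod f B) = (\<Sum>b\<in>B. w i (f b))"
  using assms(2)
  by (induction B rule: infinite_finite_induct) (auto simp: w_one w_mult assms(1) quot_group_prod)

lemma idl_cong: "(\<And>i. i \<in> I \<Longrightarrow> m i = m' i) \<Longrightarrow> idl m = idl m'"
  by (auto simp: idl_def)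

lemma idl_zero: "idl (\<lambda>_. 0) = H"
  using mem_iff subset_quot_group by (auto simp: idl_def)

lemma idl_subset: "idl m \<subseteq> L"
  by (auto simp: idl_def)

text \<open>A power of a normalized element has value \<open>m i\<close> at \<open>i\<close>; a high
  power of the element from \<open>independent\<close> keeps that value and lifts all others. Hence
  the bounds are sharp, and \<open>m\<close> can be recovered on \<open>I\<close> from the
  ideal.\<close>

lemma idl_attains:
  assumes "i \<in> I"
  shows "\<exists>x\<in>idl m. w i x = m i"
proof -
  obtain z where z: "z \<in> L" "w i z = 1"
    using normalized assms by blast
  obtain t where t: "t \<in> L" "w i t = 0" "\<forall>k\<in>I - {i}. 0 < w k t"
    using independent assms by blast
  define y where "y = z powi m i"
  \<comment> \<open>One exponent dominating every deficit \<open>m k - w k y\<close> at once; it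
    suffices because the positive integers \<open>w k t\<close> are at least 1.\<close>
  define N where "N = (\<Sum>k\<in>I. nat \<bar>m k - w k y\<bar>)"
  have y: "y \<in> L" "w i y = m i"
    using z assms by (auto simp: y_def quot_group_power_int w_power_int)
  have "m k \<le> w k (y * t ^ N)" if "k \<in> I" for k
  proof (cases "k = i")
    case True
    then show ?thesis
      using y t assms by (simp add: w_mult quot_group_power w_power)
  next
    case False
    have "nat \<bar>m k - w k y\<bar> \<le> N"
      unfolding N_def using that finite_I member_le_sum[of k I "\<lambda>k. nat \<bar>m k - w k y\<bar>"] by simp
    then have "m k - w k y \<le> int N * 1"
      by linarith
    also have "\<dots> \<le> int N * w k t"
      using t(3) False that by (intro mult_left_mono) (auto simp: int_one_le_iff_zero_less)
    finally show ?thesis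
      using that y t by (simp add: w_mult quot_group_power w_power)
  qed
  moreover have "w i (y * t ^ N) = m i"
    using y t assms by (simp add: w_mult quot_group_power w_power)
  moreover have "y * t ^ N \<in> L"
    using y t by (simp add: quot_group_mult quot_group_power)
  ultimately show ?thesis
    by (auto simp: idl_def)
qed

lemma idl_nonempty: "idl m \<noteq> {}"
proof (cases "I = {}")
  case True
  then have "1 \<in> idl m"
    using one_quot_group unfolding idl_def by simp
  then show ?thesis
    by blast
next
  case False
  then show ?thesis
    using idl_attains by blast
qed

lemma idl_le_iff: "idl m \<subseteq> idl m' \<longleftrightarrow> (\<forall>i\<in>I. m' i \<le> m i)"
proof
  assume "idl m \<subseteq> idl m'"
  then show "\<forall>i\<in>I. m' i \<le> m i"
    using idl_attains[of _ m] by (force simp: idl_def)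
qed (force simp: idl_def)

lemma idl_eq_iff: "idl m = idl m' \<longleftrightarrow> (\<forall>i\<in>I. m i = m' i)"
  by (metis idl_le_iff idl_cong order.refl order.antisym)

text \<open>Only the componentwise minimum of the values on \<open>Y\<close> enters its inverse: the
  bound gives one inclusion, attainment the other. This is applied to ideals \<open>idl m\<close>,
  to their set products and to arbitrary v-ideals.\<close>

lemma inv_set_eq_idl:
  assumes "Y \<subseteq> L" "\<And>y i. y \<in> Y \<Longrightarrow> i \<in> I \<Longrightarrow> m i \<le> w i y" "\<And>i. i \<in> I \<Longrightarrow> \<exists>y\<in>Y. w i y = m i"
  shows "inv_set H Y = idl (\<lambda>i. - m i)"
proof -
  have "(z *o Y \<subseteq> H) \<longleftrightarrow> (\<forall>i\<in>I. - m i \<le> w i z)" if z: "z \<in> L" for z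
  proof -
    have mem: "z * y \<in> H \<longleftrightarrow> (\<forall>i\<in>I. 0 \<le> w i z + w i y)" if "y \<in> Y" for y
      using that assms(1) z by (subst mem_iff) (auto simp: quot_group_mult w_mult subset_iff)
    show ?thesis
    proof
      assume "z *o Y \<subseteq> H"
      then have zy: "\<forall>y\<in>Y. z * y \<in> H"
        by (auto simp: elt_set_times_def)
      show "\<forall>i\<in>I. - m i \<le> w i z"
      proof
        fix i assume i: "i \<in> I"
        then obtain y where "y \<in> Y" "w i y = m i"
          using assms(3) by blast
        then show "- m i \<le> w i z"
          using zy mem[of y] i by force
      qed
    next
      assume *: "\<forall>i\<in>I. - m i \<le> w i z"
      have "0 \<le> w i z + w i y" if "y \<in> Y" "i \<in> I" for y i
        using * assms(2)[OF that] that by force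
      then show "z *o Y \<subseteq> H"
        using mem by (auto simp: elt_set_times_def)
    qed
  qed
  then show ?thesis
    by (auto simp: inv_set_def idl_def)
qed

lemma inv_set_idl: "inv_set H (idl m) = idl (\<lambda>i. - m i)"
  by (rule inv_set_eq_idl) (use idl_attains in \<open>auto simp: idl_def\<close>)

lemma v_closure_idl: "v_closure H (idl m) = idl m"
  by (simp add: v_closure_def inv_set_idl)

lemma idl_mult: "x \<in> idl m \<Longrightarrow> y \<in> idl m' \<Longrightarrow> x * y \<in> idl (\<lambda>i. m i + m' i)"
  by (auto simp: idl_def quot_group_mult w_mult intro!: add_mono)

text \<open>Minima of values add, so the set product has the same inverse as the ideal with the
  summed bounds. This turns v-multiplication into addition of integer vectors.\<close>

lemma v_closure_idl_mult: "v_closure H (idl m * idl m') = idl (\<lambda>i. m i + m' i)"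
proof -
  have "inv_set H (idl m * idl m') = idl (\<lambda>i. - (m i + m' i))"
  proof (rule inv_set_eq_idl)
    show "idl m * idl m' \<subseteq> L"
      using idl_subset by (auto simp: set_times_def intro!: quot_group_mult)
    show "m i + m' i \<le> w i y" if "y \<in> idl m * idl m'" "i \<in> I" for y i
      using that idl_mult[of _ m _ m'] by (force simp: set_times_def idl_def)
    show "\<exists>y\<in>idl m * idl m'. w i y = m i + m' i" if i: "i \<in> I" for i
    proof -
      obtain x y where "x \<in> idl m" "w i x = m i" "y \<in> idl m'" "w i y = m' i"
        using idl_attains[OF i] by metis
      then show ?thesis
        using i by (intro bexI[of _ "x * y"]) (auto simp: w_mult idl_def)
    qed
  qed
  then show ?thesis
    by (simp only: v_closure_def inv_set_idl minus_minus)
qed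

lemma idl_mult_H: "idl m * H = idl m"
proof
  show "idl m * H \<subseteq> idl m"
    using idl_mult[of _ m _ "\<lambda>_. 0"] by (auto simp: set_times_def idl_zero)
  show "idl m \<subseteq> idl m * H"
    using one_mem by (force simp: set_times_def)
qed

lemma principal_eq_idl:
  assumes "z \<in> L"
  shows "z *o H = idl (\<lambda>i. w i z)"
proof
  show "z *o H \<subseteq> idl (\<lambda>i. w i z)"
    using assms subset_quot_group mem_iff
    by (auto simp: elt_set_times_def idl_def quot_group_mult w_mult subset_iff)
  show "idl (\<lambda>i. w i z) \<subseteq> z *o H"
  proof
    fix x assume x: "x \<in> idl (\<lambda>i. w i z)"
    have "x * inverse z \<in> H"
      using x assms
      by (subst mem_iff) (auto simp: idl_def quot_group_mult quot_group_inverse w_mult w_inverse)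
    then show "x \<in> z *o H"
      using quot_group_nonzero[OF assms] by (auto simp: elt_set_times_def intro!: bexI[of _ "x * inverse z"])
  qed
qed

text \<open>A common denominator bounds each value from below on a fractional ideal, so
  componentwise minima exist; a v-ideal is then recovered from them through its inverse.\<close>

lemma frac_v_ideals_eq: "frac_v_ideals H = range idl"
proof
  show "range idl \<subseteq> frac_v_ideals H"
  proof clarify
    fix m
    \<comment> \<open>Values at least 0 put \<open>c\<close> into \<open>H\<close>; values at least
      \<open>- m i\<close> make it a common denominator.\<close>
    obtain c where c: "c \<in> idl (\<lambda>i. max 0 (- m i))"
      using idl_nonempty by blast
    then have "c \<in> H"
      by (auto simp: mem_iff idl_def)
    moreover have "c *o idl m \<subseteq> H"
    proof
      fix x assume "x \<in> c *o idl m"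
      then obtain y where y: "y \<in> idl m" "x = c * y"
        by (auto simp: elt_set_times_def)
      have "c \<in> idl (\<lambda>i. - m i)"
        using c by (auto simp: idl_def)
      from idl_mult[OF this y(1)] show "x \<in> H"
        by (simp add: y(2) idl_zero)
    qed
    ultimately show "idl m \<in> frac_v_ideals H"
      unfolding frac_v_ideals_def
      using idl_nonempty idl_subset idl_mult_H v_closure_idl by blast
  qed
  show "frac_v_ideals H \<subseteq> range idl"
  proof
    fix J assume "J \<in> frac_v_ideals H"
    then obtain c where J: "J \<noteq> {}" "J \<subseteq> L" "c \<in> H" "c *o J \<subseteq> H" "v_closure H J = J"
      by (auto simp: frac_v_ideals_def)
    have c: "c \<in> L"
      using J subset_quot_group by blast
    have "\<exists>n. \<exists>y\<in>J. w i y = n \<and> (\<forall>y'\<in>J. n \<le> w i y')" if i: "i \<in> I" for i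
    proof -
      have "- w i c \<le> w i y" if "y \<in> J" for y
      proof -
        have "c * y \<in> H"
          using J that by (auto simp: elt_set_times_def)
        moreover have "c * y \<in> L"
          using that J(2) c quot_group_mult by blast
        ultimately have "0 \<le> w i (c * y)"
          using mem_iff i by blast
        then show ?thesis
          using w_mult[of i c y] c that J(2) i by auto
      qed
      \<comment> \<open>Shifting by \<open>w i c\<close> makes the values on \<open>J\<close>
        nonnegative, so that least elements exist among natural numbers.\<close>
      moreover obtain y where "y \<in> J" "\<forall>y'. y' \<in> J \<longrightarrow> nat (w i y + w i c) \<le> nat (w i y' + w i c)"
        using J(1) ex_has_least_nat[of "\<lambda>y. y \<in> J" _ "\<lambda>y. nat (w i y + w i c)"] by blast
      ultimately show ?thesis
        by (intro exI[of _ "w i y"] bexI[of _ y]) force+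
    qed
    then have "\<forall>i. \<exists>n. i \<in> I \<longrightarrow> (\<exists>y\<in>J. w i y = n \<and> (\<forall>y'\<in>J. n \<le> w i y'))"
      by blast
    from choice[OF this] obtain m where
      "\<And>i. i \<in> I \<Longrightarrow> \<exists>y\<in>J. w i y = m i \<and> (\<forall>y'\<in>J. m i \<le> w i y')"
      by blast
    then have "inv_set H J = idl (\<lambda>i. - m i)"
      using J(2) by (intro inv_set_eq_idl) blast+
    then have "J = idl m"
      using J(5) by (simp add: v_closure_def inv_set_idl)
    then show "J \<in> range idl"
      by blast
  qed
qed

subsection \<open>Minimal primes\<close>

text \<open>For \<open>i\<close> in \<open>I\<close> these are the elements of \<open>H\<close> with
  positive value at \<open>i\<close>. The encoding by a unit vector turns products and classes of
  primes into vector arithmetic.\<close>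

definition prime_at :: "'i \<Rightarrow> 'f set" where
  "prime_at i = idl (\<lambda>k. if k = i then 1 else 0)"

lemma prime_at_eq: "i \<in> I \<Longrightarrow> prime_at i = {z \<in> H. 0 < w i z}"
proof -
  assume i: "i \<in> I"
  have "(\<forall>k\<in>I. (if k = i then 1 else 0) \<le> w k z) \<longleftrightarrow> (\<forall>k\<in>I. 0 \<le> w k z) \<and> 0 < w i z" for z
    using i by (metis (full_types) int_one_le_iff_zero_less less_imp_le)
  then show ?thesis
    using subset_quot_group mem_iff by (auto simp: prime_at_def idl_def)
qed

lemma prime_at_prime:
  assumes i: "i \<in> I"
  shows "prime_s_ideal H (prime_at i)"
proof -
  have "x * y \<in> H - prime_at i" if "x \<in> H - prime_at i" "y \<in> H - prime_at i" for x y
  proof -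
    have "x \<in> L" "y \<in> L" "w i x \<le> 0" "w i y \<le> 0"
      using that subset_quot_group i by (auto simp: prime_at_eq)
    then show ?thesis
      using that i by (auto simp: prime_at_eq w_mult mult_mem)
  qed
  moreover have "1 \<in> H - prime_at i"
    using i one_mem by (auto simp: prime_at_eq w_one)
  moreover have "s_ideal H (prime_at i)"
    unfolding s_ideal_def
  proof
    show "prime_at i \<subseteq> H"
      using i by (auto simp: prime_at_eq)
    show "prime_at i * H = prime_at i"
      by (simp add: prime_at_def idl_mult_H)
  qed
  ultimately show ?thesis
    by (auto simp: prime_s_ideal_def)
qed

text \<open>Otherwise elements of the \<open>prime_at i\<close> outside \<open>Q\<close> multiply to
  an element outside \<open>Q\<close> with all values positive. Some power of it is a multiple of a
  given \<open>q\<close> in \<open>Q\<close>, although all its powers stay outside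
  \<open>Q\<close>.\<close>

lemma prime_at_below:
  assumes Q: "prime_s_ideal H Q" "Q \<noteq> {}"
  shows "\<exists>i\<in>I. prime_at i \<subseteq> Q"
proof (rule ccontr)
  assume "\<not> ?thesis"
  then have "\<forall>i\<in>I. \<exists>z. z \<in> prime_at i \<and> z \<notin> Q"
    by blast
  then obtain z where z: "\<And>i. i \<in> I \<Longrightarrow> z i \<in> prime_at i" "\<And>i. i \<in> I \<Longrightarrow> z i \<notin> Q"
    by metis
  have one: "1 \<in> H - Q" and mult: "\<And>x y. x \<in> H - Q \<Longrightarrow> y \<in> H - Q \<Longrightarrow> x * y \<in> H - Q"
    and QH: "Q * H = Q" "Q \<subseteq> H"
    using Q by (auto simp: prime_s_ideal_def s_ideal_def)
  have zH: "z i \<in> H" "0 < w i (z i)" if "i \<in> I" for i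
    using z(1)[OF that] that by (auto simp: prime_at_eq)
  have prod_notin: "prod z J \<in> H - Q" if "J \<subseteq> I" for J
    using that
  proof (induction J rule: infinite_finite_induct)
    case (insert i J)
    then show ?case
      using mult[of "z i" "prod z J"] z(2) zH(1) by simp
  qed (use one in simp_all)
  have pos: "0 < w i (prod z I)" if i: "i \<in> I" for i
  proof -
    have "0 \<le> w i (z k)" if "k \<in> I" for k
      using zH(1)[OF that] mem_iff subset_quot_group i by blast
    then have "w i (z i) \<le> (\<Sum>k\<in>I. w i (z k))"
      using i finite_I by (intro member_le_sum) auto
    also have "\<dots> = w i (prod z I)"
      using w_prod[OF i, of I z] zH(1) subset_quot_group by (simp add: subset_iff)
    finally show ?thesis
      using zH(2)[OF i] by simp
  qed
  have powers: "prod z I ^ k \<in> H - Q" for k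
    by (induction k) (use one mult prod_notin in auto)
  obtain q where q: "q \<in> Q"
    using Q by blast
  then have qL: "q \<in> L"
    using QH subset_quot_group by blast
  \<comment> \<open>\<open>N\<close> bounds all values of \<open>q\<close>, so \<open>r\<close> has
    nonnegative values and lies in \<open>H\<close>.\<close>
  define N where "N = (\<Sum>k\<in>I. nat \<bar>w k q\<bar>)"
  define r where "r = prod z I ^ N * inverse q"
  have pL: "prod z I \<in> L"
    using prod_notin subset_quot_group by auto
  have "0 \<le> w i r" if i: "i \<in> I" for i
  proof -
    have "nat \<bar>w i q\<bar> \<le> N"
      unfolding N_def using i finite_I member_le_sum[of i I "\<lambda>k. nat \<bar>w k q\<bar>"] by simp
    then have "w i q \<le> int N * 1"
      by linarith
    also have "\<dots> \<le> int N * w i (prod z I)"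
      using pos[OF i] by (intro mult_left_mono) auto
    finally show ?thesis
      using i pL qL by (simp add: r_def w_mult w_inverse w_power quot_group_power quot_group_inverse)
  qed
  then have "r \<in> H"
    using mem_iff pL qL by (auto simp: r_def quot_group_mult quot_group_power quot_group_inverse)
  then have "q * r \<in> Q * H"
    using q by blast
  moreover have "q * r = prod z I ^ N"
    using quot_group_nonzero[OF qL] by (simp add: r_def)
  ultimately show False
    using powers QH by auto
qed

text \<open>Each \<open>prime_at i\<close> is prime, every nonempty prime contains one of them, and
  comparing bounds in coordinate \<open>i\<close> shows that they are pairwise incomparable.\<close>

lemma min_primes_eq: "min_primes H = prime_at ` I"
proof -
  have incomparable: "k = i" if "prime_at k \<subseteq> prime_at i" "i \<in> I" "k \<in> I" for i k
    using that by (auto simp: prime_at_def idl_le_iff split: if_splits dest!: bspec[of _ _ i])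
  have nonempty: "prime_at i \<noteq> {}" for i
    by (simp add: prime_at_def idl_nonempty)
  have "prime_at i \<in> min_primes H" if i: "i \<in> I" for i
  proof -
    have "Q = prime_at i" if Q: "prime_s_ideal H Q" "Q \<noteq> {}" "Q \<subseteq> prime_at i" for Q
    proof -
      obtain k where k: "k \<in> I" "prime_at k \<subseteq> Q"
        using prime_at_below Q by blast
      then have "k = i"
        using incomparable Q i by blast
      then show ?thesis
        using k Q by blast
    qed
    then show ?thesis
      using prime_at_prime[OF i] nonempty by (auto simp: min_primes_def)
  qed
  moreover have "min_primes H \<subseteq> prime_at ` I"
  proof
    fix P assume "P \<in> min_primes H"
    then have P: "prime_s_ideal H P" "P \<noteq> {}" "\<And>Q. prime_s_ideal H Q \<Longrightarrow> Q \<noteq> {} \<Longrightarrow> Q \<subseteq> P \<Longrightarrow> Q = P"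
      by (auto simp: min_primes_def)
    then obtain i where i: "i \<in> I" "prime_at i \<subseteq> P"
      using prime_at_below by blast
    then have "prime_at i = P"
      using P(3)[OF prime_at_prime[OF i(1)] nonempty] by blast
    then show "P \<in> prime_at ` I"
      using i by blast
  qed
  ultimately show ?thesis
    by (simp add: image_subset_iff subset_antisym)
qed

end

lemma (in Group.comm_group) seq_sum_mset_set:
  assumes "A \<subseteq> carrier G" "finite A"
  shows "seq_sum G (mset_set A) = finprod G (\<lambda>x. x) A"
  unfolding seq_sum_def using assms by (intro finprod_cong') (auto simp: subset_iff)

text \<open>This lets subsequences of a multiplicity-free sequence be treated as subsets.\<close>

lemma subset_mset_set_imp_mset_set:
  assumes "T \<subset># mset_set A" "finite A"
  shows "\<exists>C. C \<subset> A \<and> T = mset_set C"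
proof -
  have "count T x \<le> 1" for x
    using mset_subset_eq_count[OF subset_mset.less_imp_le[OF assms(1)], of x] assms(2)
    by (auto simp: count_mset_set' split: if_splits)
  then have T: "T = mset_set (set_mset T)"
    by (intro multiset_eqI) (metis count_mset_set(1,3) finite_set_mset le_antisym not_in_iff count_greater_eq_one_iff)
  moreover have "set_mset T \<subseteq> A"
    using set_mset_mono[OF subset_mset.less_imp_le[OF assms(1)]] assms(2) by simp
  moreover have "set_mset T \<noteq> A"
    using T assms(1) by auto
  ultimately show ?thesis
    by blast
qed

context finite_krull
begin

subsection \<open>The divisor class group\<close>

abbreviation "V \<equiv> v_ideal_monoid H"

lemma carrier_V: "carrier V = range idl"
  by (simp add: v_ideal_monoid_def frac_v_ideals_eq)

lemma one_V: "\<one>\<^bsub>V\<^esub> = idl (\<lambda>_. 0)"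
  by (simp add: v_ideal_monoid_def idl_zero)

lemma mult_V: "idl m \<otimes>\<^bsub>V\<^esub> idl m' = idl (\<lambda>i. m i + m' i)"
  by (simp add: v_ideal_monoid_def v_closure_idl_mult)

lemma comm_group_V: "Group.comm_group V"
proof (rule comm_groupI)
  show "\<And>x. x \<in> carrier V \<Longrightarrow> \<exists>y\<in>carrier V. y \<otimes>\<^bsub>V\<^esub> x = \<one>\<^bsub>V\<^esub>"
  proof -
    fix x assume "x \<in> carrier V"
    then obtain m where "x = idl m"
      by (auto simp: carrier_V)
    then show "\<exists>y\<in>carrier V. y \<otimes>\<^bsub>V\<^esub> x = \<one>\<^bsub>V\<^esub>"
      by (intro bexI[of _ "idl (\<lambda>i. - m i)"]) (simp_all add: carrier_V mult_V one_V)
  qed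
qed (auto simp: carrier_V one_V mult_V add_ac)

lemma principal_frac_ideals_eq: "principal_frac_ideals H = {idl (\<lambda>i. w i z) |z. z \<in> L}"
  using principal_eq_idl by (force simp: principal_frac_ideals_def)

lemma idl_principal_iff:
  "idl m \<in> principal_frac_ideals H \<longleftrightarrow> (\<exists>z\<in>L. \<forall>i\<in>I. m i = w i z)"
  by (auto simp: principal_frac_ideals_eq idl_eq_iff)

lemma subgroup_principal: "subgroup (principal_frac_ideals H) V"
proof -
  interpret V: Group.comm_group V
    by (rule comm_group_V)
  show ?thesis
  proof (rule V.subgroupI)
    show "principal_frac_ideals H \<subseteq> carrier V"
      by (auto simp: principal_frac_ideals_eq carrier_V)
    show "principal_frac_ideals H \<noteq> {}"
      using one_quot_group by (auto simp: principal_frac_ideals_eq)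
    fix x assume "x \<in> principal_frac_ideals H"
    then obtain z where z: "z \<in> L" "x = idl (\<lambda>i. w i z)"
      by (auto simp: principal_frac_ideals_eq)
    have "idl (\<lambda>i. w i (inverse z)) \<otimes>\<^bsub>V\<^esub> x = \<one>\<^bsub>V\<^esub>"
      using z by (auto simp: mult_V one_V w_inverse idl_eq_iff)
    then have "inv\<^bsub>V\<^esub> x = idl (\<lambda>i. w i (inverse z))"
      using z by (intro V.inv_equality) (auto simp: carrier_V)
    then show "inv\<^bsub>V\<^esub> x \<in> principal_frac_ideals H"
      using quot_group_inverse z by (auto simp: idl_principal_iff)
    fix y assume "y \<in> principal_frac_ideals H"
    then obtain z' where z': "z' \<in> L" "y = idl (\<lambda>i. w i z')"
      by (auto simp: principal_frac_ideals_eq)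
    show "x \<otimes>\<^bsub>V\<^esub> y \<in> principal_frac_ideals H"
      using z z' by (auto simp: mult_V idl_principal_iff w_mult intro!: bexI[of _ "z * z'"] quot_group_mult)
  qed
qed

lemma comm_group_class_group: "Group.comm_group (v_class_group H)"
  unfolding v_class_group_def
  by (rule comm_group.abelian_FactGroup[OF comm_group_V subgroup_principal])

lemma ideal_class_closed: "ideal_class H (idl m) \<in> carrier (v_class_group H)"
  by (auto simp: v_class_group_def ideal_class_def carrier_FactGroup carrier_V)

lemma ideal_class_mult:
  "ideal_class H (idl m) \<otimes>\<^bsub>v_class_group H\<^esub> ideal_class H (idl m') = ideal_class H (idl (\<lambda>i. m i + m' i))"
proof -
  interpret V: Group.comm_group V
    by (rule comm_group_V)
  interpret N: normal "principal_frac_ideals H" V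
    by (rule V.subgroup_imp_normal[OF subgroup_principal])
  show ?thesis
    by (simp add: v_class_group_def ideal_class_def N.rcos_sum carrier_V mult_V)
qed

lemma ideal_class_eq_one_iff:
  "ideal_class H (idl m) = \<one>\<^bsub>v_class_group H\<^esub> \<longleftrightarrow> (\<exists>z\<in>L. \<forall>i\<in>I. m i = w i z)"
proof -
  interpret V: Group.comm_group V
    by (rule comm_group_V)
  have "ideal_class H (idl m) = \<one>\<^bsub>v_class_group H\<^esub> \<longleftrightarrow> idl m \<in> principal_frac_ideals H"
    using V.coset_join1[OF _ _ subgroup_principal, of "idl m"]
      V.coset_join2[OF _ subgroup_principal, of "idl m"]
    by (auto simp: v_class_group_def ideal_class_def carrier_V)
  then show ?thesis
    by (simp add: idl_principal_iff)
qed

lemma ideal_class_eq_iff: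
  "ideal_class H (idl m) = ideal_class H (idl m') \<longleftrightarrow> (\<exists>z\<in>L. \<forall>i\<in>I. m i - m' i = w i z)"
proof -
  interpret C: Group.comm_group "v_class_group H"
    by (rule comm_group_class_group)
  have eq: "ideal_class H (idl m) = ideal_class H (idl (\<lambda>i. m i - m' i)) \<otimes>\<^bsub>v_class_group H\<^esub> ideal_class H (idl m')"
    by (simp add: ideal_class_mult)
  show ?thesis
    unfolding ideal_class_eq_one_iff[symmetric]
    using ideal_class_closed C.r_cancel_one'[of "ideal_class H (idl m')"] by (simp add: eq eq_commute)
qed

text \<open>The class group is the cokernel of the value map \<open>z \<mapsto> (w i z)\<close>, so a surjection \<open>\<phi>\<close>
  onto \<open>\<int>\<^sup>J\<close> with the value vectors as kernel identifies it.\<close>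

lemma v_class_group_iso:
  fixes \<phi> :: "('i \<Rightarrow> int) \<Rightarrow> 'j \<Rightarrow> int"
  assumes add: "\<And>m m' j. j \<in> J \<Longrightarrow> \<phi> (\<lambda>i. m i + m' i) j = \<phi> m j + \<phi> m' j"
    and cong: "\<And>m m' j. j \<in> J \<Longrightarrow> (\<And>i. i \<in> I \<Longrightarrow> m i = m' i) \<Longrightarrow> \<phi> m j = \<phi> m' j"
    and surj: "\<And>v. \<exists>m. \<forall>j\<in>J. \<phi> m j = v j"
    and kernel: "\<And>m. (\<forall>j\<in>J. \<phi> m j = 0) \<longleftrightarrow> (\<exists>z\<in>L. \<forall>i\<in>I. m i = w i z)"
  shows "v_class_group H \<cong> product_group J (\<lambda>_. integer_group)"
proof -
  interpret V: Group.comm_group V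
    by (rule comm_group_V)
  define G where "G = product_group J (\<lambda>_. integer_group)"
  \<comment> \<open>\<open>inv_into\<close> picks some vector representing the ideal; representing
    vectors agree on \<open>I\<close>, so \<open>cong\<close> makes the choice harmless.\<close>
  define h where "h Y = restrict (\<phi> (inv_into UNIV idl Y)) J" for Y
  have h_idl: "h (idl m) = (\<lambda>j\<in>J. \<phi> m j)" for m
  proof -
    have "idl (inv_into UNIV idl (idl m)) = idl m"
      by (simp add: f_inv_into_f)
    then show ?thesis
      unfolding h_def idl_eq_iff using cong by (intro restrict_ext) blast
  qed
  interpret G: Group.group G
    by (simp add: G_def)
  have "h \<in> hom V G"
    by (rule homI) (auto simp: carrier_V G_def h_idl mult_V add)
  then interpret h: group_hom V G h
    by unfold_locales
  have "h ` carrier V = carrier G"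
  proof
    show "h ` carrier V \<subseteq> carrier G"
      using h.hom_closed by blast
    show "carrier G \<subseteq> h ` carrier V"
    proof
      fix v assume v: "v \<in> carrier G"
      obtain m where "\<forall>j\<in>J. \<phi> m j = v j"
        using surj by blast
      then have "v = h (idl m)"
        using v by (auto simp: h_idl G_def PiE_def extensional_def)
      then show "v \<in> h ` carrier V"
        by (simp add: carrier_V)
    qed
  qed
  from h.FactGroup_iso[OF this] have "V Mod kernel V G h \<cong> G" .
  moreover have "kernel V G h = principal_frac_ideals H"
  proof -
    have "h (idl m) = \<one>\<^bsub>G\<^esub> \<longleftrightarrow> idl m \<in> principal_frac_ideals H" for m
      unfolding idl_principal_iff kernel[symmetric]
      by (auto simp: h_idl G_def fun_eq_iff restrict_def)
    moreover have "principal_frac_ideals H \<subseteq> range idl"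
      by (auto simp: principal_frac_ideals_eq)
    ultimately show ?thesis
      by (auto simp: kernel_def carrier_V)
  qed
  ultimately show ?thesis
    by (simp add: v_class_group_def G_def)
qed

subsection \<open>A lower bound for the Davenport constant\<close>

text \<open>Classes multiply by adding exponent vectors, and distinct primes produce an indicator
  vector. Zero-sum questions thus become questions of principality.\<close>

lemma finprod_prime_classes:
  assumes "finite A"
  shows "finprod (v_class_group H) (\<lambda>i. ideal_class H (prime_at i)) A
    = ideal_class H (idl (\<lambda>i. if i \<in> A then 1 else 0))"
proof -
  interpret C: Group.comm_group "v_class_group H"
    by (rule comm_group_class_group)
  show ?thesis
    using assms
  proof (induction A)
    case empty
    have "ideal_class H (idl (\<lambda>i. 0)) = \<one>\<^bsub>v_class_group H\<^esub>"
      unfolding ideal_class_eq_one_iff using one_quot_group w_one by force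
    then show ?case
      by simp
  next
    case (insert k A)
    have "idl (\<lambda>i. (if i = k then 1 else 0) + (if i \<in> A then 1 else 0))
      = idl (\<lambda>i. if i \<in> insert k A then 1 else 0)"
      using insert.hyps by (intro idl_cong) auto
    then show ?case
      using insert by (simp add: ideal_class_closed prime_at_def ideal_class_mult)
  qed
qed

text \<open>By \<open>principal\<close> the prime classes indexed by \<open>A\<close> sum to zero,
  and by \<open>not_principal\<close> no nonempty proper subfamily does. Injectivity makes the
  sequence multiplicity-free, so its length is \<open>card A\<close> and its subsequences correspond
  to subsets.\<close>

lemma davenport_ge_card:
  assumes A: "A \<subseteq> I" "A \<noteq> {}"
    and principal: "\<exists>z\<in>L. \<forall>i\<in>I. w i z = (if i \<in> A then 1 else 0)"
    and not_principal: "\<And>B z. B \<subset> A \<Longrightarrow> B \<noteq> {} \<Longrightarrow> z \<in> L \<Longrightarrow> \<exists>i\<in>I. w i z \<noteq> (if i \<in> B then 1 else 0)"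
    and inj: "inj_on (\<lambda>i. ideal_class H (prime_at i)) A"
  shows "enat (card A) \<le> davenport (v_class_group H) (ideal_class H ` min_primes H)"
proof -
  interpret C: Group.comm_group "v_class_group H"
    by (rule comm_group_class_group)
  define g where "g i = ideal_class H (prime_at i)" for i
  have fin: "finite A"
    using A finite_I finite_subset by blast
  have g_closed: "g i \<in> carrier (v_class_group H)" for i
    by (simp add: g_def prime_at_def ideal_class_closed)
  have sum: "seq_sum (v_class_group H) (mset_set (g ` B)) = ideal_class H (idl (\<lambda>i. if i \<in> B then 1 else 0))"
    if "B \<subseteq> A" for B
  proof -
    have B: "finite B" "inj_on g B"
      using that fin inj by (auto simp: g_def[abs_def] intro: finite_subset inj_on_subset)
    have "seq_sum (v_class_group H) (mset_set (g ` B)) = finprod (v_class_group H) g B"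
      using B g_closed C.finprod_reindex[of "\<lambda>x. x" g B]
      by (force simp: C.seq_sum_mset_set Pi_def image_subset_iff)
    then show ?thesis
      using finprod_prime_classes[OF B(1)] by (simp add: g_def[abs_def])
  qed
  have "minimal_zero_sum (v_class_group H) (mset_set (g ` A))"
    unfolding minimal_zero_sum_def
  proof (intro conjI allI impI)
    show "mset_set (g ` A) \<noteq> {#}"
      using A fin by (simp add: mset_set_empty_iff)
    show "seq_sum (v_class_group H) (mset_set (g ` A)) = \<one>\<^bsub>v_class_group H\<^esub>"
    proof -
      obtain z where "z \<in> L" "\<forall>i\<in>I. w i z = (if i \<in> A then 1 else 0)"
        using principal by blast
      then show ?thesis
        unfolding sum[OF order.refl] ideal_class_eq_one_iff by (intro bexI[of _ z]) simp_all
    qed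
    fix T assume T: "T \<noteq> {#} \<and> T \<subset># mset_set (g ` A)"
    then obtain C where C: "C \<subset> g ` A" "T = mset_set C"
      using subset_mset_set_imp_mset_set fin by blast
    then obtain B where B: "B \<subseteq> A" "C = g ` B"
      by (meson psubset_imp_subset subset_image_iff)
    then have "B \<subset> A" "B \<noteq> {}"
      using C T by auto
    then show "seq_sum (v_class_group H) T \<noteq> \<one>\<^bsub>v_class_group H\<^esub>"
      unfolding C(2) B(2) sum[OF B(1)] ideal_class_eq_one_iff using not_principal[of B] by metis
  qed
  moreover have "set_mset (mset_set (g ` A)) \<subseteq> ideal_class H ` min_primes H"
    using A fin by (auto simp: min_primes_eq g_def)
  moreover have "size (mset_set (g ` A)) = card A"
    using inj by (simp add: card_image g_def[abs_def])
  ultimately show ?thesis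
    unfolding davenport_def by (metis (mono_tags, lifting) SUP_upper mem_Collect_eq)
qed

text \<open>The assumption provides a generator \<open>c\<close> for the v-product of two primes.
  The case \<open>k = i\<close> is allowed and then asks for value 2 at \<open>i\<close>.\<close>

lemma min_primes_inverse:
  assumes "\<And>i. i \<in> I \<Longrightarrow> \<exists>k\<in>I. \<exists>c\<in>H. \<forall>j\<in>I. w j c = (if j = i then 1 else 0) + (if j = k then 1 else 0)"
  shows "\<forall>P\<in>min_primes H. \<exists>Q\<in>min_primes H. \<exists>c\<in>H. v_closure H (P * Q) = c *o H"
proof
  fix P assume "P \<in> min_primes H"
  then obtain i where i: "i \<in> I" "P = prime_at i"
    by (auto simp: min_primes_eq)
  then obtain k c where k: "k \<in> I" "c \<in> H"
    "\<forall>j\<in>I. w j c = (if j = i then 1 else 0) + (if j = k then 1 else 0)"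
    using assms by meson
  then have "v_closure H (P * prime_at k) = c *o H"
    unfolding i(2) prime_at_def v_closure_idl_mult using subset_quot_group
    by (subst principal_eq_idl) (auto intro!: idl_cong)
  moreover have "prime_at k \<in> min_primes H"
    using k(1) by (simp add: min_primes_eq)
  ultimately show "\<exists>Q\<in>min_primes H. \<exists>c\<in>H. v_closure H (P * Q) = c *o H"
    using k(2) by blast
qed

end

subsection \<open>Monoids of monomials with exponents in a polyhedral cone\<close>

text \<open>The quotient group is \<open>U\<close> times a free abelian group on the
  \<open>g b\<close>, and the forms \<open>\<Lambda> i\<close> cut the monoid out of it. The
  interior point makes every monomial a quotient of monoid elements; normalization and independence
  of the forms yield those of the valuations in \<open>finite_krull\<close>.\<close>

locale cone_monoid =
  fixes U :: "'f::field set" and B :: "'b set" and g :: "'b \<Rightarrow> 'f"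
    and I :: "'i set" and \<Lambda> :: "'i \<Rightarrow> ('b \<Rightarrow> int) \<Rightarrow> int"
  assumes U_one: "1 \<in> U" and U_zero: "0 \<notin> U"
    and U_mult: "\<lbrakk>u \<in> U; v \<in> U\<rbrakk> \<Longrightarrow> u * v \<in> U" and U_inverse: "u \<in> U \<Longrightarrow> inverse u \<in> U"
    and finite_B: "finite B" and finite_I: "finite I"
    and g_nonzero: "b \<in> B \<Longrightarrow> g b \<noteq> 0"
    and exponents_unique: "\<lbrakk>(\<Prod>b\<in>B. g b powi l b) \<in> U; b \<in> B\<rbrakk> \<Longrightarrow> l b = 0"
    and \<Lambda>_add: "i \<in> I \<Longrightarrow> \<Lambda> i (\<lambda>b. l b + l' b) = \<Lambda> i l + \<Lambda> i l'"
    and \<Lambda>_cong: "\<lbrakk>i \<in> I; \<And>b. b \<in> B \<Longrightarrow> l b = l' b\<rbrakk> \<Longrightarrow> \<Lambda> i l = \<Lambda> i l'"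
    and \<Lambda>_normalized: "i \<in> I \<Longrightarrow> \<exists>l. \<Lambda> i l = 1"
    and \<Lambda>_independent: "i \<in> I \<Longrightarrow> \<exists>l. \<Lambda> i l = 0 \<and> (\<forall>k\<in>I - {i}. 0 < \<Lambda> k l)"
    and \<Lambda>_interior: "\<exists>l. \<forall>i\<in>I. 0 < \<Lambda> i l"
begin

definition mon :: "('b \<Rightarrow> int) \<Rightarrow> 'f" where
  "mon l = (\<Prod>b\<in>B. g b powi l b)"

definition cone :: "'f set" where
  "cone = {u * mon l |u l. u \<in> U \<and> (\<forall>i\<in>I. 0 \<le> \<Lambda> i l)}"

text \<open>The chosen exponent vector is arbitrary outside \<open>B\<close>;
  \<open>weight_monomial\<close> shows that the choice does not affect the value.\<close>

definition weight :: "'i \<Rightarrow> 'f \<Rightarrow> int" where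
  "weight i z = \<Lambda> i (SOME l. \<exists>u\<in>U. z = u * mon l)"

lemma coneI: "\<lbrakk>u \<in> U; \<And>i. i \<in> I \<Longrightarrow> 0 \<le> \<Lambda> i l\<rbrakk> \<Longrightarrow> u * mon l \<in> cone"
  unfolding cone_def by blast

lemma mon_nonzero: "mon l \<noteq> 0"
  using g_nonzero finite_B by (simp add: mon_def power_int_not_zero)

lemma mon_zero: "mon (\<lambda>_. 0) = 1"
  by (simp add: mon_def)

lemma mon_add: "mon (\<lambda>b. l b + l' b) = mon l * mon l'"
  unfolding mon_def prod.distrib[symmetric] using g_nonzero
  by (intro prod.cong) (simp_all add: power_int_add)

lemma mon_uminus: "mon (\<lambda>b. - l b) = inverse (mon l)"
  using mon_add[of l "\<lambda>b. - l b"] by (simp add: mon_zero inverse_unique)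

lemma \<Lambda>_zero: "i \<in> I \<Longrightarrow> \<Lambda> i (\<lambda>_. 0) = 0"
  using \<Lambda>_add[of i "\<lambda>_. 0" "\<lambda>_. 0"] by simp

lemma \<Lambda>_scale: "i \<in> I \<Longrightarrow> \<Lambda> i (\<lambda>b. int k * l b) = int k * \<Lambda> i l"
proof (induction k)
  case (Suc k)
  then show ?case
    using \<Lambda>_add[of i l "\<lambda>b. int k * l b"] by (simp add: algebra_simps)
qed (simp add: \<Lambda>_zero)

text \<open>Two representations of one element differ by a monomial in \<open>U\<close>, whose
  exponents vanish on \<open>B\<close>.\<close>

lemma weight_monomial:
  assumes "u \<in> U" "i \<in> I"
  shows "weight i (u * mon l) = \<Lambda> i l"
proof -
  let ?l = "SOME l'. \<exists>v\<in>U. u * mon l = v * mon l'"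
  have "\<exists>v\<in>U. u * mon l = v * mon ?l"
    by (rule someI[of _ l]) (use assms in blast)
  then obtain v where v: "v \<in> U" "u * mon l = v * mon ?l"
    by blast
  have "mon (\<lambda>b. l b + - ?l b) = inverse u * v"
    unfolding mon_add mon_uminus using v assms U_zero mon_nonzero[of ?l]
    by (auto simp: field_simps)
  also have "\<dots> \<in> U"
    using v assms by (simp add: U_mult U_inverse)
  finally have "l b = ?l b" if "b \<in> B" for b
    using exponents_unique[of "\<lambda>b. l b + - ?l b" b] that by (simp add: mon_def)
  then show ?thesis
    unfolding weight_def using assms(2) by (intro \<Lambda>_cong) simp_all
qed

lemma cone_submonoid: "cancellative_submonoid cone"
proof
  show "0 \<notin> cone"
    using U_zero mon_nonzero by (auto simp: cone_def)
  show "1 \<in> cone"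
    using U_one mon_zero \<Lambda>_zero unfolding cone_def by force
  fix x y assume "x \<in> cone" "y \<in> cone"
  then obtain u l v l' where "x = u * mon l" "y = v * mon l'" "u \<in> U" "v \<in> U"
    "\<forall>i\<in>I. 0 \<le> \<Lambda> i l" "\<forall>i\<in>I. 0 \<le> \<Lambda> i l'"
    by (auto simp: cone_def)
  then have "x * y = u * v * mon (\<lambda>b. l b + l' b)" "u * v \<in> U" "\<forall>i\<in>I. 0 \<le> \<Lambda> i (\<lambda>b. l b + l' b)"
    by (auto simp: mon_add \<Lambda>_add U_mult)
  then show "x * y \<in> cone"
    unfolding cone_def by blast
qed

lemma quot_group_cone: "quot_group cone = {u * mon l |u l. u \<in> U}"
proof
  show "quot_group cone \<subseteq> {u * mon l |u l. u \<in> U}"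
  proof
    fix z assume "z \<in> quot_group cone"
    then obtain u l v l' where *: "z = (u * mon l) / (v * mon l')" "u \<in> U" "v \<in> U"
      by (auto simp: quot_group_def cone_def)
    then have "z = u * inverse v * mon (\<lambda>b. l b + - l' b)"
      unfolding mon_add mon_uminus by (simp add: field_simps)
    then show "z \<in> {u * mon l |u l. u \<in> U}"
      using * by (blast intro: U_mult U_inverse)
  qed
  show "{u * mon l |u l. u \<in> U} \<subseteq> quot_group cone"
  proof clarify
    fix u l assume u: "u \<in> U"
    obtain l0 where l0: "\<And>i. i \<in> I \<Longrightarrow> 0 < \<Lambda> i l0"
      using \<Lambda>_interior by blast
    \<comment> \<open>A large multiple of an interior exponent vector pushes \<open>l\<close> into
      the cone and also serves as the denominator.\<close>
    define N where "N = (\<Sum>k\<in>I. nat \<bar>\<Lambda> k l\<bar>)"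
    define l1 where "l1 b = int N * l0 b" for b
    have \<Lambda>1: "\<Lambda> i l1 = int N * \<Lambda> i l0" if "i \<in> I" for i
      unfolding l1_def using that by (rule \<Lambda>_scale)
    have "0 \<le> \<Lambda> i l1" "0 \<le> \<Lambda> i (\<lambda>b. l b + l1 b)" if i: "i \<in> I" for i
    proof -
      have "nat \<bar>\<Lambda> i l\<bar> \<le> N"
        unfolding N_def using i finite_I member_le_sum[of i I "\<lambda>k. nat \<bar>\<Lambda> k l\<bar>"] by simp
      then have "- \<Lambda> i l \<le> int N * 1"
        by linarith
      also have "\<dots> \<le> int N * \<Lambda> i l0"
        using l0[OF i] by (intro mult_left_mono) auto
      finally show "0 \<le> \<Lambda> i (\<lambda>b. l b + l1 b)"
        using i by (simp add: \<Lambda>_add \<Lambda>1)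
      show "0 \<le> \<Lambda> i l1"
        using l0[OF i] i by (simp add: \<Lambda>1)
    qed
    then have "u * mon (\<lambda>b. l b + l1 b) \<in> cone" "1 * mon l1 \<in> cone"
      using u U_one by (blast intro: coneI)+
    moreover have "u * mon l = (u * mon (\<lambda>b. l b + l1 b)) / (1 * mon l1)"
      using mon_nonzero by (simp add: mon_add)
    ultimately show "u * mon l \<in> quot_group cone"
      unfolding quot_group_def by blast
  qed
qed

lemma weights_realized: "\<exists>z\<in>quot_group cone. \<forall>i\<in>I. weight i z = \<Lambda> i l"
  using U_one by (intro bexI[of _ "1 * mon l"]) (simp add: weight_monomial del: mult_1, force simp: quot_group_cone)

lemma weights_from_exponents: "z \<in> quot_group cone \<Longrightarrow> \<exists>l. \<forall>i\<in>I. weight i z = \<Lambda> i l"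
  by (auto simp: quot_group_cone weight_monomial)

sublocale krull: finite_krull cone I weight
proof -
  interpret cancellative_submonoid cone
    by (rule cone_submonoid)
  show "finite_krull cone I weight"
  proof
    show "finite I"
      by (rule finite_I)
    show "weight i (x * y) = weight i x + weight i y"
      if i: "i \<in> I" and xy: "x \<in> quot_group cone" "y \<in> quot_group cone" for i x y
    proof -
      obtain u l v l' where *: "x = u * mon l" "y = v * mon l'" "u \<in> U" "v \<in> U"
        using xy unfolding quot_group_cone by blast
      have "x * y = (u * v) * mon (\<lambda>b. l b + l' b)"
        by (simp add: * mon_add)
      then have "weight i (x * y) = \<Lambda> i (\<lambda>b. l b + l' b)"
        using weight_monomial[OF U_mult[OF *(3,4)] i] by simp
      moreover have "weight i x = \<Lambda> i l" "weight i y = \<Lambda> i l'"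
        using * i weight_monomial by simp_all
      ultimately show ?thesis
        by (simp only: \<Lambda>_add[OF i])
    qed
    show "z \<in> cone \<longleftrightarrow> (\<forall>i\<in>I. 0 \<le> weight i z)" if z: "z \<in> quot_group cone" for z
    proof -
      obtain u l where *: "z = u * mon l" "u \<in> U"
        using z by (auto simp: quot_group_cone)
      then have "\<forall>i\<in>I. weight i z = \<Lambda> i l"
        by (simp add: weight_monomial)
      moreover have "\<forall>i\<in>I. 0 \<le> weight i z" if "z \<in> cone"
        using that by (auto simp: cone_def weight_monomial)
      ultimately show ?thesis
        using * unfolding cone_def by auto
    qed
    show "\<exists>z\<in>quot_group cone. weight i z = 1" if "i \<in> I" for i
      using \<Lambda>_normalized[OF that] weights_realized that by metis
    show "\<exists>t\<in>quot_group cone. weight i t = 0 \<and> (\<forall>k\<in>I - {i}. 0 < weight k t)" if i: "i \<in> I" for i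
    proof -
      obtain l where l: "\<Lambda> i l = 0" "\<forall>k\<in>I - {i}. 0 < \<Lambda> k l"
        using \<Lambda>_independent i by blast
      moreover obtain z where "z \<in> quot_group cone" "\<forall>k\<in>I. weight k z = \<Lambda> k l"
        using weights_realized by blast
      ultimately show ?thesis
        using i by (intro bexI[of _ z]) auto
    qed
  qed
qed

end

subsection \<open>Divisors of products of primes\<close>

text \<open>In each step the prime \<open>f\<close> divides either \<open>h\<close> or its cofactor
  and is cancelled there.\<close>

lemma dvd_prime_elem_power_mult:
  fixes f :: "'a::idom"
  assumes "prime_elem f" "h dvd f ^ k * F"
  shows "\<exists>e\<le>k. \<exists>h'. h = f ^ e * h' \<and> h' dvd F"
  using assms(2)
proof (induction k arbitrary: h)
  case (Suc k)
  have f: "f \<noteq> 0"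
    using assms(1) by auto
  obtain g where g: "f * (f ^ k * F) = h * g"
    using Suc.prems by (auto simp: dvd_def mult.assoc)
  then have "f dvd h \<or> f dvd g"
    using assms(1) by (metis dvd_triv_left prime_elem_dvd_mult_iff)
  then show ?case
  proof
    assume "f dvd h"
    then obtain h1 where h1: "h = f * h1" ..
    then have "h1 dvd f ^ k * F"
      using g f by (metis dvd_triv_left mult.assoc mult_left_cancel)
    then obtain e h' where "e \<le> k" "h1 = f ^ e * h'" "h' dvd F"
      using Suc.IH by blast
    then show ?thesis
      by (intro exI[of _ "Suc e"] conjI exI[of _ h']) (simp_all add: h1 mult.assoc)
  next
    assume "f dvd g"
    then obtain g1 where "g = f * g1" ..
    then have "h dvd f ^ k * F"
      using g f by (metis dvd_triv_left mult.left_commute mult_left_cancel)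
    then show ?thesis
      using Suc.IH le_SucI by blast
  qed
qed auto

text \<open>The primes are split off one at a time; what finally remains of \<open>h\<close> divides
  1.\<close>

lemma dvd_prod_prime_elem_powers:
  fixes f :: "'i \<Rightarrow> 'a::idom"
  assumes "finite A" "\<And>i. i \<in> A \<Longrightarrow> prime_elem (f i)" "h dvd (\<Prod>i\<in>A. f i ^ k i)"
  shows "\<exists>e u. (\<forall>i\<in>A. e i \<le> k i) \<and> u dvd 1 \<and> h = u * (\<Prod>i\<in>A. f i ^ e i)"
  using assms
proof (induction A arbitrary: h)
  case (insert j A)
  have "h dvd f j ^ k j * (\<Prod>i\<in>A. f i ^ k i)"
    using insert by simp
  then obtain d h' where d: "d \<le> k j" "h = f j ^ d * h'" "h' dvd (\<Prod>i\<in>A. f i ^ k i)"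
    using dvd_prime_elem_power_mult insert.prems(1) by blast
  then obtain e u where e: "\<forall>i\<in>A. e i \<le> k i" "u dvd 1" "h' = u * (\<Prod>i\<in>A. f i ^ e i)"
    using insert.IH insert.prems(1) by blast
  have "(\<Prod>i\<in>A. f i ^ (e(j := d)) i) = (\<Prod>i\<in>A. f i ^ e i)"
    using insert.hyps by (intro prod.cong) auto
  then have "h = u * (\<Prod>i\<in>insert j A. f i ^ (e(j := d)) i)"
    using insert.hyps d e by (simp add: mult_ac)
  then show ?case
    using d e insert.hyps by (intro exI[of _ "e(j := d)"] exI[of _ u]) auto
qed auto

lemma not_dvd_prime_elem_prod_power:
  fixes q :: "'a::idom"
  assumes "prime_elem q" "\<And>i. i \<in> A \<Longrightarrow> \<not> q dvd f i"
  shows "\<not> q dvd (\<Prod>i\<in>A. f i ^ e i)"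
  using assms(2)
proof (induction A rule: infinite_finite_induct)
  case (insert i A)
  then show ?case
    using assms(1) prime_elem_dvd_power[of q "f i" "e i"] by (auto simp: prime_elem_dvd_mult_iff)
qed (use assms(1) in \<open>auto dest: prime_elem_not_unit\<close>)

text \<open>The quotient \<open>x / y\<close> is a unit times an integral power of \<open>\<pi>\<close>, without denominators.\<close>

lemma associated_up_to_prime_power:
  fixes x y \<pi> :: "'a::{factorial_semiring, idom_divide}"
  assumes "x \<noteq> 0" "y \<noteq> 0" and \<pi>: "prime_elem \<pi>"
    and same: "\<And>q. prime_elem q \<Longrightarrow> \<not> \<pi> dvd q \<Longrightarrow> multiplicity q x = multiplicity q y"
  shows "\<exists>u. u dvd 1 \<and> x * \<pi> ^ multiplicity \<pi> y = u * y * \<pi> ^ multiplicity \<pi> x"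
proof -
  have \<pi>0: "\<pi> \<noteq> 0"
    using \<pi> by auto
  \<comment> \<open>At primes associated with \<open>\<pi>\<close> both sides have the sum of the
    two multiplicities; at all others the powers of \<open>\<pi>\<close> contribute nothing and
    \<open>same\<close> applies.\<close>
  have "multiplicity q (x * \<pi> ^ multiplicity \<pi> y) = multiplicity q (y * \<pi> ^ multiplicity \<pi> x)"
    if "Factorial_Ring.prime q" for q
  proof -
    have q: "prime_elem q"
      using that by simp
    show ?thesis
    proof (cases "\<pi> dvd q")
      case True
      then obtain v where v: "q = \<pi> * v" ..
      then have "v dvd 1"
        using irreducibleD[OF prime_elem_imp_irreducible[OF q] v] prime_elem_not_unit[OF \<pi>] by blast
      then have "multiplicity q z = multiplicity \<pi> z" for z
        unfolding v mult.commute[of \<pi> v] by (simp add: multiplicity_times_unit_left)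
      then show ?thesis
        using assms \<pi>0 by (simp add: prime_elem_multiplicity_mult_distrib)
    next
      case False
      then have "\<not> q dvd \<pi>"
        using irreducibleD'[OF prime_elem_imp_irreducible[OF \<pi>]] q prime_elem_not_unit by blast
      then have "multiplicity q \<pi> = 0"
        by (rule not_dvd_imp_multiplicity_0)
      then show ?thesis
        using assms(1,2) \<pi>0 same[OF q False]
        by (simp add: prime_elem_multiplicity_mult_distrib[OF q] prime_elem_multiplicity_power_distrib[OF q])
    qed
  qed
  then have "normalize (x * \<pi> ^ multiplicity \<pi> y) = normalize (y * \<pi> ^ multiplicity \<pi> x)"
    using assms \<pi>0 by (intro multiplicity_eq_imp_eq) auto
  then obtain u where "u dvd 1" "x * \<pi> ^ multiplicity \<pi> y = u * (y * \<pi> ^ multiplicity \<pi> x)"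
    by (metis associatedE1 mult.commute)
  then show ?thesis
    by (auto simp: mult.assoc)
qed

lemma to_fract_power: "to_fract (x ^ n) = to_fract x ^ n"
  by (induction n) auto

lemma to_fract_prod: "to_fract (prod f A) = (\<Prod>i\<in>A. to_fract (f i))"
  by (induction A rule: infinite_finite_induct) auto

subsection \<open>Divisors of powers of a product of linear polynomials\<close>

locale quotient_field_embedding =
  fixes \<iota> :: "'r::{factorial_semiring, idom_divide} \<Rightarrow> 'k::field"
  assumes quotient_field: "quotient_field \<iota>"
begin

lemma \<iota>_1 [simp]: "\<iota> 1 = 1"
  and \<iota>_add [simp]: "\<iota> (x + y) = \<iota> x + \<iota> y"
  and \<iota>_mult [simp]: "\<iota> (x * y) = \<iota> x * \<iota> y"
  and \<iota>_eq_iff [simp]: "\<iota> x = \<iota> y \<longleftrightarrow> x = y"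
  using quotient_field by (auto simp: quotient_field_def inj_def)

lemma fraction: "\<exists>x y. y \<noteq> 0 \<and> z = \<iota> x / \<iota> y"
  using quotient_field unfolding quotient_field_def by blast

lemma \<iota>_0 [simp]: "\<iota> 0 = 0"
  using \<iota>_add[of 0 0] by (metis add_0 add_cancel_right_left)

lemma \<iota>_eq_0_iff [simp]: "\<iota> x = 0 \<longleftrightarrow> x = 0"
  using \<iota>_eq_iff[of x 0] by simp

lemma \<iota>_diff [simp]: "\<iota> (x - y) = \<iota> x - \<iota> y"
  using \<iota>_add[of "x - y" y] by (simp del: \<iota>_add)

lemma \<iota>_power [simp]: "\<iota> (x ^ n) = \<iota> x ^ n"
  by (induction n) auto

lemma \<iota>_prod: "\<iota> (prod f A) = (\<Prod>i\<in>A. \<iota> (f i))"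
  by (induction A rule: infinite_finite_induct) auto

lemma divide_in_range_iff: "y \<noteq> 0 \<Longrightarrow> \<iota> x / \<iota> y \<in> range \<iota> \<longleftrightarrow> y dvd x"
proof
  assume "y \<noteq> 0" "\<iota> x / \<iota> y \<in> range \<iota>"
  then obtain z where "\<iota> x = \<iota> (y * z)"
    by (auto simp: field_simps)
  then show "y dvd x"
    by (simp only: \<iota>_eq_iff dvd_triv_left)
qed auto

lemma unit_inverse: "u dvd 1 \<Longrightarrow> \<exists>v. v dvd 1 \<and> inverse (\<iota> u) = \<iota> v"
proof -
  assume "u dvd 1"
  then obtain v where v: "1 = u * v" ..
  then have "\<iota> u * \<iota> v = 1"
    by (simp flip: \<iota>_mult)
  then show ?thesis
    using v dvd_triv_right[of v u] inverse_unique by auto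
qed

end

text \<open>\<open>distinct_roots\<close> says that the roots \<open>p i / a i\<close> differ, with
  denominators cleared.\<close>

locale linear_product = quotient_field_embedding \<iota>
  for \<iota> :: "'r::{factorial_semiring, idom_divide} \<Rightarrow> 'k::field" +
  fixes A :: "'i set" and a p :: "'i \<Rightarrow> 'r"
  assumes finite_A: "finite A"
    and a_nonzero: "i \<in> A \<Longrightarrow> a i \<noteq> 0"
    and distinct_roots: "\<lbrakk>i \<in> A; j \<in> A; i \<noteq> j\<rbrakk> \<Longrightarrow> a i * p j \<noteq> a j * p i"
begin

definition lin :: "'i \<Rightarrow> 'k poly" where
  "lin i = [:- \<iota> (p i), \<iota> (a i):]"

definition val :: "'i \<Rightarrow> 'r \<Rightarrow> 'r" where
  "val i c = a i * c - p i"

text \<open>Integer-valuedness of a constant times powers of the linear factors, expressed by values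
  so that it becomes divisibility in the ring.\<close>

definition integral :: "'k \<Rightarrow> ('i \<Rightarrow> nat) \<Rightarrow> bool" where
  "integral b e \<longleftrightarrow> (\<forall>c. b * \<iota> (\<Prod>i\<in>A. val i c ^ e i) \<in> range \<iota>)"

lemma poly_lin: "poly (lin i) (\<iota> c) = \<iota> (val i c)"
  by (simp add: lin_def val_def mult.commute)

lemma lin_nonzero: "i \<in> A \<Longrightarrow> lin i \<noteq> 0"
  using a_nonzero by (simp add: lin_def)

lemma prime_elem_lin: "i \<in> A \<Longrightarrow> prime_elem (lin i)"
  unfolding lin_def using a_nonzero by (intro prime_elem_linear_field_poly) simp

lemma prod_lin_nonzero: "(\<Prod>i\<in>A. lin i ^ e i) \<noteq> 0"
  using finite_A lin_nonzero by auto

lemma integral_iff: "smult b (\<Prod>i\<in>A. lin i ^ e i) \<in> Int_poly \<iota> \<longleftrightarrow> integral b e"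
  by (simp add: Int_poly_def integral_def poly_prod poly_lin \<iota>_prod)

text \<open>Over the field the linear factors are prime, so a divisor is a constant times a product
  of them, and its cofactor has the inverse constant and the complementary exponents. The
  subtraction \<open>k - e i\<close> is exact on \<open>A\<close> because
  \<open>e i \<le> k\<close>.\<close>

lemma divisors_of_powers_iff:
  "h \<in> divisors_of_powers \<iota> (\<Prod>i\<in>A. lin i) \<longleftrightarrow>
    (\<exists>b e k. b \<noteq> 0 \<and> (\<forall>i\<in>A. e i \<le> k) \<and> h = smult b (\<Prod>i\<in>A. lin i ^ e i) \<and>
      integral b e \<and> integral (inverse b) (\<lambda>i. k - e i))"
proof
  assume "h \<in> divisors_of_powers \<iota> (\<Prod>i\<in>A. lin i)"
  then obtain k g where h: "h \<in> Int_poly \<iota>" "g \<in> Int_poly \<iota>" "(\<Prod>i\<in>A. lin i) ^ k = h * g"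
    by (auto simp: divisors_of_powers_def)
  then have hg: "(\<Prod>i\<in>A. lin i ^ k) = h * g"
    by (simp add: prod_power_distrib)
  then have "h dvd (\<Prod>i\<in>A. lin i ^ k)"
    by simp
  then obtain e u where e: "\<forall>i\<in>A. e i \<le> k" "u dvd 1" "h = u * (\<Prod>i\<in>A. lin i ^ e i)"
    using dvd_prod_prime_elem_powers[OF finite_A, where f = lin and k = "\<lambda>_. k"] prime_elem_lin
    by blast
  obtain b where "u = [:b:]" "b dvd 1"
    using e(2) is_unit_poly_iff by blast
  then have b: "b \<noteq> 0" "h = smult b (\<Prod>i\<in>A. lin i ^ e i)"
    using e(3) by auto
  have "(\<Prod>i\<in>A. lin i ^ k) = (\<Prod>i\<in>A. lin i ^ e i) * (\<Prod>i\<in>A. lin i ^ (k - e i))"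
    unfolding prod.distrib[symmetric] using e(1) by (intro prod.cong) (simp_all flip: power_add)
  then have "(\<Prod>i\<in>A. lin i ^ e i) * smult b g = (\<Prod>i\<in>A. lin i ^ e i) * (\<Prod>i\<in>A. lin i ^ (k - e i))"
    using hg b by simp
  then have "smult b g = (\<Prod>i\<in>A. lin i ^ (k - e i))"
    using prod_lin_nonzero by (simp only: mult_left_cancel[OF prod_lin_nonzero])
  then have "g = smult (inverse b) (\<Prod>i\<in>A. lin i ^ (k - e i))"
    using b by (metis left_inverse smult_1_left smult_smult)
  then show "\<exists>b e k. b \<noteq> 0 \<and> (\<forall>i\<in>A. e i \<le> k) \<and> h = smult b (\<Prod>i\<in>A. lin i ^ e i) \<and>
      integral b e \<and> integral (inverse b) (\<lambda>i. k - e i)"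
    using b e h integral_iff by blast
next
  assume "\<exists>b e k. b \<noteq> 0 \<and> (\<forall>i\<in>A. e i \<le> k) \<and> h = smult b (\<Prod>i\<in>A. lin i ^ e i) \<and>
      integral b e \<and> integral (inverse b) (\<lambda>i. k - e i)"
  then obtain b e k where *: "b \<noteq> 0" "\<forall>i\<in>A. e i \<le> k" "h = smult b (\<Prod>i\<in>A. lin i ^ e i)"
      "integral b e" "integral (inverse b) (\<lambda>i. k - e i)"
    by blast
  have "(\<Prod>i\<in>A. lin i) ^ k = (\<Prod>i\<in>A. lin i ^ e i) * (\<Prod>i\<in>A. lin i ^ (k - e i))"
    unfolding prod.distrib[symmetric] prod_power_distrib using *(2)
    by (intro prod.cong) (simp_all flip: power_add)
  then have "(\<Prod>i\<in>A. lin i) ^ k = h * smult (inverse b) (\<Prod>i\<in>A. lin i ^ (k - e i))"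
    using * by simp
  moreover have "h \<in> Int_poly \<iota>" "smult (inverse b) (\<Prod>i\<in>A. lin i ^ (k - e i)) \<in> Int_poly \<iota>"
    using * by (simp_all add: integral_iff)
  moreover have "h \<noteq> 0"
    using *(1,3) prod_lin_nonzero by simp
  ultimately show "h \<in> divisors_of_powers \<iota> (\<Prod>i\<in>A. lin i)"
    unfolding divisors_of_powers_def by blast
qed

text \<open>At \<open>c\<close> the product of linear values is prime to \<open>q\<close>, so only
  \<open>x\<close> can cancel the \<open>q\<close>-part of \<open>y\<close>.\<close>

lemma integral_multiplicity_le:
  assumes "integral (\<iota> x / \<iota> y) e" "x \<noteq> 0" "y \<noteq> 0" "prime_elem q" "\<And>i. i \<in> A \<Longrightarrow> \<not> q dvd val i c"
  shows "multiplicity q y \<le> multiplicity q x"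
proof -
  define v where "v = (\<Prod>i\<in>A. val i c ^ e i)"
  have v: "\<not> q dvd v"
    unfolding v_def using assms by (intro not_dvd_prime_elem_prod_power) auto
  then have v0: "v \<noteq> 0"
    by auto
  have "\<iota> (x * v) / \<iota> y \<in> range \<iota>"
    using assms(1) by (simp add: integral_def v_def)
  then have "y dvd x * v"
    using assms(3) divide_in_range_iff by blast
  then have "multiplicity q y \<le> multiplicity q (x * v)"
    using assms v0 by (intro dvd_imp_multiplicity_le) auto
  then show ?thesis
    using assms v0 v by (simp add: prime_elem_multiplicity_mult_distrib not_dvd_imp_multiplicity_0)
qed

text \<open>The fraction and its inverse are the constants of a divisor and its cofactor. The same
  \<open>c\<close> serves both exponent vectors and gives both inequalities.\<close>

lemma divisors_fraction_multiplicity_eq: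
  assumes "integral (\<iota> x / \<iota> y) e" "integral (inverse (\<iota> x / \<iota> y)) e'" "x \<noteq> 0" "y \<noteq> 0"
    "prime_elem q" "\<And>i. i \<in> A \<Longrightarrow> \<not> q dvd val i c"
  shows "multiplicity q x = multiplicity q y"
  using integral_multiplicity_le[of x y e q c] integral_multiplicity_le[of y x e' q c] assms
  by (intro antisym) auto

text \<open>After clearing negative exponents, compare the zeros of both sides at the root of \<open>lin i\<close>.\<close>

lemma lin_powers_independent:
  assumes eq: "(\<Prod>i\<in>A. to_fract (lin i) powi l i) = to_fract [:c:]" and i: "i \<in> A"
  shows "l i = 0"
proof -
  define r where "r = \<iota> (p i) / \<iota> (a i)"
  \<comment> \<open>Positive and negative part of \<open>l j\<close>; at most one of them is
    nonzero.\<close>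
  define N M where "N j = nat (l j)" and "M j = nat (- l j)" for j
  have root: "poly (lin j) r = 0 \<longleftrightarrow> j = i" if "j \<in> A" for j
  proof -
    have "poly (lin j) r = 0 \<longleftrightarrow> \<iota> (a j * p i) = \<iota> (a i * p j)"
      using a_nonzero[OF i] by (simp add: lin_def r_def field_simps)
    then show ?thesis
      unfolding \<iota>_eq_iff using distinct_roots[OF that i] by auto
  qed
  have "to_fract (lin j) powi l j * to_fract (lin j ^ M j) = to_fract (lin j ^ N j)" if "j \<in> A" for j
    using lin_nonzero[OF that] by (auto simp: power_int_def N_def M_def to_fract_power field_simps)
  then have "(\<Prod>i\<in>A. to_fract (lin i) powi l i) * (\<Prod>j\<in>A. to_fract (lin j ^ M j)) = (\<Prod>j\<in>A. to_fract (lin j ^ N j))"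
    unfolding prod.distrib[symmetric] by (intro prod.cong) auto
  then have "to_fract ([:c:] * (\<Prod>j\<in>A. lin j ^ M j)) = to_fract (\<Prod>j\<in>A. lin j ^ N j)"
    unfolding eq by (simp only: to_fract_mult to_fract_prod)
  then have eq': "[:c:] * (\<Prod>j\<in>A. lin j ^ M j) = (\<Prod>j\<in>A. lin j ^ N j)"
    by (simp only: to_fract_eq_iff)
  have c: "c \<noteq> 0"
    using eq' prod_lin_nonzero[of N] by auto
  from eq' have "poly ([:c:] * (\<Prod>j\<in>A. lin j ^ M j)) r = poly (\<Prod>j\<in>A. lin j ^ N j) r"
    by simp
  then have "(\<Prod>j\<in>A. poly (lin j) r ^ M j) = 0 \<longleftrightarrow> (\<Prod>j\<in>A. poly (lin j) r ^ N j) = 0"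
    using c by (auto simp: poly_prod)
  \<comment> \<open>At \<open>r\<close> such a product vanishes exactly when its exponent at
    \<open>i\<close> is positive. So \<open>N i\<close> and \<open>M i\<close> are both positive or
    both zero, and as parts of one integer they are both zero.\<close>
  moreover have "(\<Prod>j\<in>A. poly (lin j) r ^ K j) = 0 \<longleftrightarrow> 0 < K i" for K
    using finite_A root i by (auto simp: prod_zero_iff)
  ultimately show ?thesis
    by (auto simp: N_def M_def)
qed

end

context linear_product
begin

definition U :: "'k poly fract set" where
  "U = {to_fract [:\<iota> u:] |u. u dvd 1}"

lemma U_group:
  "1 \<in> U" "0 \<notin> U" "u \<in> U \<Longrightarrow> v \<in> U \<Longrightarrow> u * v \<in> U" "u \<in> U \<Longrightarrow> inverse u \<in> U"
proof -
  show "1 \<in> U"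
    unfolding U_def by (rule CollectI, rule exI[of _ 1]) (simp flip: one_pCons)
  show "0 \<notin> U"
    by (auto simp: U_def)
  show "u * v \<in> U" if uv: "u \<in> U" "v \<in> U"
  proof -
    obtain x y where xy: "u = to_fract [:\<iota> x:]" "v = to_fract [:\<iota> y:]" "x dvd 1" "y dvd 1"
      using uv unfolding U_def by blast
    then have "u * v = to_fract [:\<iota> (x * y):]" "x * y dvd 1"
      by (simp_all add: is_unit_mult_iff flip: to_fract_mult)
    then show ?thesis
      unfolding U_def by blast
  qed
  show "inverse u \<in> U" if u: "u \<in> U"
  proof -
    obtain x where x: "u = to_fract [:\<iota> x:]" "x dvd 1"
      using u unfolding U_def by blast
    then obtain y where y: "x * y = 1"
      by (metis dvdE)
    have "u * to_fract [:\<iota> y:] = to_fract [:\<iota> (x * y):]"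
      by (simp add: x mult.commute flip: to_fract_mult)
    then have "u * to_fract [:\<iota> y:] = 1"
      unfolding y by (simp flip: one_pCons)
    then have "inverse u = to_fract [:\<iota> y:]"
      by (rule inverse_unique)
    moreover have "y dvd 1"
      using y by (metis dvd_triv_right)
    ultimately show ?thesis
      unfolding U_def by blast
  qed
qed

end

lemma to_fract_const_power_int:
  "to_fract [:c::'k::field:] powi l = to_fract [:c powi l:]"
proof -
  have pow: "to_fract [:c:] ^ n = to_fract [:c ^ n:]" for c :: 'k and n
    by (simp add: poly_const_pow flip: to_fract_power)
  have "inverse (to_fract [:c:]) = to_fract [:inverse c:]"
  proof (cases "c = 0")
    case False
    have "to_fract [:c:] * to_fract [:inverse c:] = to_fract [:c * inverse c:]"
      by (simp flip: to_fract_mult)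
    with False show ?thesis
      by (intro inverse_unique) (simp flip: one_pCons)
  qed simp
  then show ?thesis
    by (simp add: power_int_def pow)
qed

subsection \<open>No fixed prime divisors\<close>

text \<open>The point \<open>c\<close> may depend on \<open>q\<close> but must serve all factors at
  once. This locale covers the case \<open>n = 1\<close>.\<close>

locale linear_product_without_fixed_divisor = linear_product \<iota> A a p
  for \<iota> :: "'r::{factorial_semiring, idom_divide} \<Rightarrow> 'k::field"
    and A :: "'i set" and a p :: "'i \<Rightarrow> 'r" +
  assumes not_fixed: "prime_elem q \<Longrightarrow> \<exists>c. \<forall>i\<in>A. \<not> q dvd val i c"
begin

text \<open>Numerator and denominator of the constant have the same multiplicity at every prime,
  hence are associated.\<close>

lemma divisors_eq:
  "divisors_of_powers \<iota> (\<Prod>i\<in>A. lin i) = {smult (\<iota> u) (\<Prod>i\<in>A. lin i ^ e i) |u e. u dvd 1}"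
proof (intro equalityI subsetI)
  fix h assume "h \<in> divisors_of_powers \<iota> (\<Prod>i\<in>A. lin i)"
  then obtain b e k where h: "b \<noteq> 0" "h = smult b (\<Prod>i\<in>A. lin i ^ e i)"
      "integral b e" "integral (inverse b) (\<lambda>i. k - e i)"
    unfolding divisors_of_powers_iff by blast
  obtain x y where b: "b = \<iota> x / \<iota> y" "y \<noteq> 0"
    using fraction by blast
  then have x: "x \<noteq> 0"
    using h by auto
  have "multiplicity q x = multiplicity q y" if "Factorial_Ring.prime q" for q
  proof -
    have q: "prime_elem q"
      using that by simp
    then show ?thesis
      using not_fixed[OF q] divisors_fraction_multiplicity_eq[OF h(3,4)[unfolded b(1)] x b(2) q] by blast
  qed
  then have "normalize x = normalize y"
    using x b by (intro multiplicity_eq_imp_eq)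
  then obtain u where "u dvd 1" "x = u * y"
    by (metis associatedE1)
  then have "b = \<iota> u"
    using b by simp
  then show "h \<in> {smult (\<iota> u) (\<Prod>i\<in>A. lin i ^ e i) |u e. u dvd 1}"
    using h \<open>u dvd 1\<close> by blast
next
  fix h assume "h \<in> {smult (\<iota> u) (\<Prod>i\<in>A. lin i ^ e i) |u e. u dvd 1}"
  then obtain u e where h: "u dvd 1" "h = smult (\<iota> u) (\<Prod>i\<in>A. lin i ^ e i)"
    by blast
  obtain v where v: "inverse (\<iota> u) = \<iota> v"
    using unit_inverse[OF h(1)] by blast
  have "integral (\<iota> u) e'" for u e'
    unfolding integral_def by (simp flip: \<iota>_mult)
  moreover have "\<forall>i\<in>A. e i \<le> (\<Sum>i\<in>A. e i)"
    using finite_A by (auto intro: member_le_sum)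
  moreover have "\<iota> u \<noteq> 0"
    using h(1) by auto
  ultimately show "h \<in> divisors_of_powers \<iota> (\<Prod>i\<in>A. lin i)"
    unfolding divisors_of_powers_iff using h v by metis
qed

lemma prod_lin_powers_in_U:
  assumes "(\<Prod>i\<in>A. to_fract (lin i) powi l i) \<in> U" "i \<in> A"
  shows "l i = 0"
  using assms lin_powers_independent unfolding U_def by blast

end

text \<open>The forms are the coordinates themselves: the cone is the orthant of nonnegative
  exponents, and the monoid is free up to units.\<close>

sublocale linear_product_without_fixed_divisor \<subseteq> cone_monoid U A "\<lambda>i. to_fract (lin i)" A "\<lambda>i l. l i"
proof
  show "\<exists>l. l i = 1" for i :: 'i
    by (rule exI[of _ "\<lambda>_. 1"]) simp
  show "\<exists>l. l i = 0 \<and> (\<forall>k\<in>A - {i}. (0::int) < l k)" for i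
    by (rule exI[of _ "\<lambda>k. if k = i then 0 else 1"]) simp
  show "\<exists>l. \<forall>i\<in>A. (0::int) < l i"
    by (rule exI[of _ "\<lambda>_. 1"]) simp
qed (use U_group finite_A lin_nonzero prod_lin_powers_in_U in auto)

context linear_product_without_fixed_divisor
begin

lemma to_fract_divisors: "to_fract ` divisors_of_powers \<iota> (\<Prod>i\<in>A. lin i) = cone"
proof -
  have mon: "to_fract (smult (\<iota> u) (\<Prod>i\<in>A. lin i ^ e i)) = to_fract [:\<iota> u:] * mon (\<lambda>i. int (e i))" for u e
  proof -
    have "to_fract (smult (\<iota> u) (\<Prod>i\<in>A. lin i ^ e i)) = to_fract ([:\<iota> u:] * (\<Prod>i\<in>A. lin i ^ e i))"
      by simp
    then show ?thesis
      by (simp only: to_fract_mult to_fract_prod to_fract_power mon_def power_int_of_nat)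
  qed
  show ?thesis
  proof (intro equalityI subsetI)
    fix z assume "z \<in> to_fract ` divisors_of_powers \<iota> (\<Prod>i\<in>A. lin i)"
    then obtain u e where "u dvd 1" "z = to_fract [:\<iota> u:] * mon (\<lambda>i. int (e i))"
      unfolding divisors_eq using mon by auto
    then show "z \<in> cone"
      using coneI[of "to_fract [:\<iota> u:]" "\<lambda>i. int (e i)"] unfolding U_def by auto
  next
    fix z assume "z \<in> cone"
    then obtain v l where "v \<in> U" "z = v * mon l" and l: "\<forall>i\<in>A. 0 \<le> l i"
      unfolding cone_def by blast
    then obtain u where z: "u dvd 1" "z = to_fract [:\<iota> u:] * mon l"
      unfolding U_def by blast
    have "smult (\<iota> u) (\<Prod>i\<in>A. lin i ^ nat (l i)) \<in> divisors_of_powers \<iota> (\<Prod>i\<in>A. lin i)"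
      unfolding divisors_eq using z(1) by (intro CollectI exI[of _ u] exI[of _ "\<lambda>i. nat (l i)"]) simp
    moreover have "mon l = mon (\<lambda>i. int (nat (l i)))"
      unfolding mon_def using l by (intro prod.cong) simp_all
    then have "z = to_fract (smult (\<iota> u) (\<Prod>i\<in>A. lin i ^ nat (l i)))"
      unfolding z(2) by (simp only: mon)
    ultimately show "z \<in> to_fract ` divisors_of_powers \<iota> (\<Prod>i\<in>A. lin i)"
      by (rule image_eqI[rotated])
  qed
qed

end

subsection \<open>A single fixed prime divisor\<close>

text \<open>The polynomials \<open>lin i\<close> are divisible by \<open>\<pi>\<close> exactly on pairwise disjoint classes of
  arguments which cover \<open>R\<close>; hence the fixed divisor of \<open>\<Prod>i. lin i ^ e i\<close> is \<open>\<pi> ^ Min e\<close>.\<close>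

locale linear_product_with_fixed_divisor = linear_product \<iota> A a p
  for \<iota> :: "'r::{factorial_semiring, idom_divide} \<Rightarrow> 'k::field"
    and A :: "'i set" and a p :: "'i \<Rightarrow> 'r" +
  fixes \<pi> :: 'r
  assumes prime_\<pi>: "prime_elem \<pi>"
    and only_fixed: "prime_elem q \<Longrightarrow> \<not> \<pi> dvd q \<Longrightarrow> \<exists>c. \<forall>i\<in>A. \<not> q dvd val i c"
    and fixed: "\<exists>i\<in>A. \<pi> dvd val i c"
    and separated: "i \<in> A \<Longrightarrow> \<exists>c. multiplicity \<pi> (val i c) = 1 \<and> (\<forall>k\<in>A - {i}. \<not> \<pi> dvd val k c)"
begin

lemma \<pi>_nonzero: "\<pi> \<noteq> 0"
  using prime_\<pi> by auto

lemma \<iota>_\<pi>_nonzero: "\<iota> \<pi> \<noteq> 0"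
  using \<pi>_nonzero by simp

text \<open>For \<open>l = - s\<close> with \<open>s > 0\<close>, the power \<open>\<pi> ^ s\<close>
  must divide all values of the product. At a point from \<open>separated\<close> the product has
  multiplicity exactly \<open>e i\<close>, which forces \<open>s \<le> e i\<close>. Conversely, at
  every point some factor is divisible by \<open>\<pi>\<close>, and its power alone contributes
  \<open>\<pi> ^ s\<close>.\<close>

lemma integral_criterion:
  assumes u: "u dvd 1"
  shows "integral (\<iota> u * \<iota> \<pi> powi l) e \<longleftrightarrow> (\<forall>i\<in>A. 0 \<le> l + int (e i))"
proof
  assume int: "integral (\<iota> u * \<iota> \<pi> powi l) e"
  show "\<forall>i\<in>A. 0 \<le> l + int (e i)"
  proof
    fix i assume i: "i \<in> A"
    obtain c where c: "multiplicity \<pi> (val i c) = 1" "\<And>k. k \<in> A - {i} \<Longrightarrow> \<not> \<pi> dvd val k c"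
      using separated[OF i] by blast
    show "0 \<le> l + int (e i)"
    proof (cases "0 \<le> l")
      case False
      define s where "s = nat (- l)"
      have l: "l = - int s"
        using False by (simp add: s_def)
      have "\<iota> (u * (\<Prod>i\<in>A. val i c ^ e i)) / \<iota> (\<pi> ^ s) \<in> range \<iota>"
        using int unfolding integral_def by (simp add: l power_int_minus field_simps)
      then have "\<pi> ^ s dvd u * (\<Prod>i\<in>A. val i c ^ e i)"
        using \<pi>_nonzero by (subst (asm) divide_in_range_iff) simp_all
      then have "\<pi> ^ s dvd (\<Prod>i\<in>A. val i c ^ e i)"
        using u by (simp add: dvd_mult_unit_iff')
      moreover define v where "v = (\<Prod>k\<in>A - {i}. val k c ^ e k)"
      moreover have v: "\<not> \<pi> dvd v"
        unfolding v_def by (rule not_dvd_prime_elem_prod_power[OF prime_\<pi> c(2)])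
      moreover have "(\<Prod>i\<in>A. val i c ^ e i) = val i c ^ e i * v"
        unfolding v_def using finite_A i by (simp add: prod.remove)
      moreover have "val i c \<noteq> 0"
        using c(1) by auto
      moreover have "v \<noteq> 0"
        using v by auto
      ultimately have "s \<le> multiplicity \<pi> (val i c ^ e i * v)"
        by (intro multiplicity_geI) (auto simp: prime_elem_not_unit[OF prime_\<pi>])
      also have "\<dots> = e i"
        using c(1) v \<open>val i c \<noteq> 0\<close> \<open>v \<noteq> 0\<close> prime_\<pi>
        by (simp add: prime_elem_multiplicity_mult_distrib prime_elem_multiplicity_power_distrib
            not_dvd_imp_multiplicity_0)
      finally show ?thesis
        by (simp add: l)
    qed simp
  qed
next
  assume le: "\<forall>i\<in>A. 0 \<le> l + int (e i)"
  have "(\<iota> u * \<iota> \<pi> powi l) * \<iota> (\<Prod>i\<in>A. val i c ^ e i) \<in> range \<iota>" for c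
  proof (cases "0 \<le> l")
    case True
    then have "(\<iota> u * \<iota> \<pi> powi l) * \<iota> (\<Prod>i\<in>A. val i c ^ e i) = \<iota> (u * \<pi> ^ nat l * (\<Prod>i\<in>A. val i c ^ e i))"
      by (simp add: power_int_def)
    then show ?thesis
      by (simp only: rangeI)
  next
    case False
    define s where "s = nat (- l)"
    have l: "l = - int s"
      using False by (simp add: s_def)
    obtain i where i: "i \<in> A" "\<pi> dvd val i c"
      using fixed by blast
    have "s \<le> e i"
      using le i(1) by (auto simp: l)
    then have "\<pi> ^ s dvd val i c ^ e i"
      using i(2) by (meson dvd_power_same le_imp_power_dvd dvd_trans)
    also have "\<dots> dvd (\<Prod>i\<in>A. val i c ^ e i)"
      using finite_A i(1) by (rule dvd_prodI)
    finally have "\<pi> ^ s dvd u * (\<Prod>i\<in>A. val i c ^ e i)"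
      by (rule dvd_mult)
    then have "\<iota> (u * (\<Prod>i\<in>A. val i c ^ e i)) / \<iota> (\<pi> ^ s) \<in> range \<iota>"
      using \<pi>_nonzero by (subst divide_in_range_iff) simp_all
    then show ?thesis
      by (simp add: l power_int_minus field_simps)
  qed
  then show "integral (\<iota> u * \<iota> \<pi> powi l) e"
    by (simp add: integral_def)
qed

text \<open>Away from \<open>\<pi>\<close> the multiplicities in the constant cancel, so it is a
  unit times a power of \<open>\<pi>\<close>, and \<open>integral_criterion\<close> gives the
  inequalities. For the converse a large \<open>k\<close> makes the cofactor integral as
  well.\<close>

lemma divisors_eq:
  "divisors_of_powers \<iota> (\<Prod>i\<in>A. lin i) =
    {smult (\<iota> u * \<iota> \<pi> powi l) (\<Prod>i\<in>A. lin i ^ e i) |u l e. u dvd 1 \<and> (\<forall>i\<in>A. 0 \<le> l + int (e i))}"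
    (is "_ = ?D")
proof (intro equalityI subsetI)
  fix h assume "h \<in> divisors_of_powers \<iota> (\<Prod>i\<in>A. lin i)"
  then obtain b e k where h: "b \<noteq> 0" "h = smult b (\<Prod>i\<in>A. lin i ^ e i)"
      "integral b e" "integral (inverse b) (\<lambda>i. k - e i)"
    unfolding divisors_of_powers_iff by blast
  obtain x y where b: "b = \<iota> x / \<iota> y" "y \<noteq> 0"
    using fraction by blast
  then have x: "x \<noteq> 0"
    using h by auto
  have "multiplicity q x = multiplicity q y" if "prime_elem q" "\<not> \<pi> dvd q" for q
    using only_fixed[OF that] divisors_fraction_multiplicity_eq[OF h(3,4)[unfolded b(1)] x b(2) that(1)] by blast
  then obtain u where u: "u dvd 1" "x * \<pi> ^ multiplicity \<pi> y = u * y * \<pi> ^ multiplicity \<pi> x"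
    using associated_up_to_prime_power[OF x b(2) prime_\<pi>] by blast
  from u(2) have "\<iota> (x * \<pi> ^ multiplicity \<pi> y) = \<iota> (u * y * \<pi> ^ multiplicity \<pi> x)"
    by (simp only:)
  then have "\<iota> y * (b * \<iota> \<pi> ^ multiplicity \<pi> y) = \<iota> y * (\<iota> u * \<iota> \<pi> ^ multiplicity \<pi> x)"
    using b by (simp add: mult_ac)
  then have "b * \<iota> \<pi> ^ multiplicity \<pi> y = \<iota> u * \<iota> \<pi> ^ multiplicity \<pi> x"
    using b(2) by (simp only: mult_left_cancel \<iota>_eq_0_iff simp_thms)
  then have "b = \<iota> u * \<iota> \<pi> powi (int (multiplicity \<pi> x) - int (multiplicity \<pi> y))"
    using \<iota>_\<pi>_nonzero by (simp add: power_int_diff field_simps)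
  then show "h \<in> ?D"
    using h u(1) integral_criterion[OF u(1)] by blast
next
  fix h assume "h \<in> ?D"
  then obtain u l e where h: "u dvd 1" "h = smult (\<iota> u * \<iota> \<pi> powi l) (\<Prod>i\<in>A. lin i ^ e i)"
    "\<forall>i\<in>A. 0 \<le> l + int (e i)"
    by blast
  obtain v where v: "v dvd 1" "inverse (\<iota> u) = \<iota> v"
    using unit_inverse[OF h(1)] by blast
  \<comment> \<open>Large enough that each \<open>k - e i\<close> is at least the absolute value of
    \<open>l\<close>, so the cofactor, with exponent \<open>- l\<close> of \<open>\<pi>\<close>, is
    integral.\<close>
  define k where "k = (\<Sum>i\<in>A. e i) + nat \<bar>l\<bar>"
  have k: "e i + nat \<bar>l\<bar> \<le> k" if "i \<in> A" for i
    unfolding k_def using that finite_A by (auto intro: member_le_sum)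
  have "integral (\<iota> u * \<iota> \<pi> powi l) e"
    using h integral_criterion by blast
  moreover have "integral (\<iota> v * \<iota> \<pi> powi (- l)) (\<lambda>i. k - e i)"
    unfolding integral_criterion[OF v(1)] using k by force
  moreover have "\<iota> v * \<iota> \<pi> powi (- l) = inverse (\<iota> u * \<iota> \<pi> powi l)"
    by (simp add: power_int_minus v(2))
  moreover have "\<iota> u * \<iota> \<pi> powi l \<noteq> 0"
    using h(1) \<iota>_\<pi>_nonzero by auto
  moreover have "\<forall>i\<in>A. e i \<le> k"
    using k by force
  ultimately show "h \<in> divisors_of_powers \<iota> (\<Prod>i\<in>A. lin i)"
    unfolding divisors_of_powers_iff h(2) by metis
qed

section \<open>The exponent cone in the presence of a fixed prime divisor\<close>

definition gen :: "'i option \<Rightarrow> 'k poly fract" where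
  "gen j = (case j of None \<Rightarrow> to_fract [:\<iota> \<pi>:] | Some i \<Rightarrow> to_fract (lin i))"

text \<open>\<open>False\<close> marks the exponent of the linear factor, \<open>True\<close> its
  sum with the exponent of \<open>\<pi>\<close>, which is stored under \<open>None\<close>.\<close>

definition form :: "'i \<times> bool \<Rightarrow> ('i option \<Rightarrow> int) \<Rightarrow> int" where
  "form k l = l (Some (fst k)) + (if snd k then l None else 0)"

lemma prod_gen:
  "(\<Prod>j\<in>insert None (Some ` A). gen j powi l j) = to_fract [:\<iota> \<pi> powi l None:] * (\<Prod>i\<in>A. to_fract (lin i) powi l (Some i))"
  using finite_A by (simp add: gen_def prod.reindex to_fract_const_power_int)

lemma \<pi>_power_unit:
  assumes "u dvd 1" "\<iota> \<pi> powi l = \<iota> u"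
  shows "l = 0"
proof (cases "0 \<le> l")
  case True
  then have "\<pi> ^ nat l = u"
    using assms(2) by (simp add: power_int_def flip: \<iota>_power)
  then show ?thesis
    using assms(1) prime_elem_not_unit[OF prime_\<pi>] True by (auto simp: is_unit_power_iff)
next
  case False
  then have "\<iota> (u * \<pi> ^ nat (- l)) = \<iota> 1"
    using \<iota>_\<pi>_nonzero assms(2) by (simp add: power_int_def field_simps split: if_splits)
  then have "\<pi> ^ nat (- l) dvd 1"
    by (metis \<iota>_eq_iff dvd_triv_right)
  then show ?thesis
    using prime_elem_not_unit[OF prime_\<pi>] False by (auto simp: is_unit_power_iff)
qed

text \<open>With the constant moved to the other side, \<open>lin_powers_independent\<close> makes
  the linear exponents vanish; the remaining power of \<open>\<pi>\<close> is then a unit.\<close>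

lemma prod_gen_in_U:
  assumes "(\<Prod>j\<in>insert None (Some ` A). gen j powi l j) \<in> U" "j \<in> insert None (Some ` A)"
  shows "l j = 0"
proof -
  obtain u where u: "u dvd 1" "to_fract [:\<iota> \<pi> powi l None:] * (\<Prod>i\<in>A. to_fract (lin i) powi l (Some i)) = to_fract [:\<iota> u:]"
    using assms(1) unfolding prod_gen U_def by auto
  have inv: "to_fract [:inverse (\<iota> \<pi> powi l None):] * to_fract [:\<iota> \<pi> powi l None:] = 1"
    using \<iota>_\<pi>_nonzero by (simp flip: to_fract_mult one_pCons)
  have "(\<Prod>i\<in>A. to_fract (lin i) powi l (Some i)) = to_fract [:inverse (\<iota> \<pi> powi l None):] * to_fract [:\<iota> u:]"
    unfolding u(2)[symmetric] mult.assoc[symmetric] inv by simp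
  also have "\<dots> = to_fract [:inverse (\<iota> \<pi> powi l None) * \<iota> u:]"
    by (simp flip: to_fract_mult)
  finally have l: "l (Some i) = 0" if "i \<in> A" for i
    using lin_powers_independent[of "\<lambda>i. l (Some i)"] that by blast
  then have "\<iota> \<pi> powi l None = \<iota> u"
    using u(2) by simp
  then have "l None = 0"
    by (rule \<pi>_power_unit[OF u(1)])
  then show ?thesis
    using l assms(2) by auto
qed

end

sublocale linear_product_with_fixed_divisor \<subseteq>
  cone_monoid U "insert None (Some ` A)" gen "A \<times> UNIV" form
proof
  show "\<exists>l. form k l = 1" for k
    by (rule exI[of _ "\<lambda>j. if j = None then 0 else 1"]) (simp add: form_def)
  show "\<exists>l. form k l = 0 \<and> (\<forall>k'\<in>A \<times> UNIV - {k}. 0 < form k' l)" for k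
  proof (cases k)
    case (Pair i s)
    \<comment> \<open>The exponent of \<open>\<pi>\<close> is chosen so that the form at
      \<open>k\<close> vanishes while its partner at the same index is 1; all other linear exponents
      are larger by 1.\<close>
    define l where "l j = (case j of None \<Rightarrow> if s then - 1 else 1
      | Some i' \<Rightarrow> (if i' = i then 0 else 1) + (if s then 1 else 0::int))" for j
    show ?thesis
      by (rule exI[of _ l]) (auto simp: form_def l_def Pair)
  qed
  show "\<exists>l. \<forall>k\<in>A \<times> UNIV. 0 < form k l"
    by (rule exI[of _ "\<lambda>j. if j = None then 0 else 1"]) (simp add: form_def)
  show "gen j \<noteq> 0" if "j \<in> insert None (Some ` A)" for j
    using that \<pi>_nonzero lin_nonzero by (auto simp: gen_def)
qed (use U_group finite_A prod_gen_in_U in \<open>auto simp: form_def\<close>)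

context linear_product_with_fixed_divisor
begin

lemma to_fract_divisors: "to_fract ` divisors_of_powers \<iota> (\<Prod>i\<in>A. lin i) = cone"
proof -
  have mon: "to_fract (smult (\<iota> u * \<iota> \<pi> powi l None) (\<Prod>i\<in>A. lin i ^ e i)) = to_fract [:\<iota> u:] * mon l"
    if "\<And>i. i \<in> A \<Longrightarrow> l (Some i) = int (e i)" for u e l
  proof -
    have "to_fract (smult (\<iota> u * \<iota> \<pi> powi l None) (\<Prod>i\<in>A. lin i ^ e i))
      = to_fract ([:\<iota> u:] * [:\<iota> \<pi> powi l None:] * (\<Prod>i\<in>A. lin i ^ e i))"
      by (simp add: mult.commute)
    also have "\<dots> = to_fract [:\<iota> u:] * (to_fract [:\<iota> \<pi> powi l None:] * (\<Prod>i\<in>A. to_fract (lin i) ^ e i))"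
      by (simp only: to_fract_mult to_fract_prod to_fract_power mult.assoc)
    also have "(\<Prod>i\<in>A. to_fract (lin i) ^ e i) = (\<Prod>i\<in>A. to_fract (lin i) powi l (Some i))"
      using that by (intro prod.cong) simp_all
    finally show ?thesis
      unfolding mon_def prod_gen .
  qed
  show ?thesis
  proof (intro equalityI subsetI)
    fix z assume "z \<in> to_fract ` divisors_of_powers \<iota> (\<Prod>i\<in>A. lin i)"
    then obtain u l e where z: "u dvd 1" "\<forall>i\<in>A. 0 \<le> l + int (e i)"
      "z = to_fract (smult (\<iota> u * \<iota> \<pi> powi l) (\<Prod>i\<in>A. lin i ^ e i))"
      unfolding divisors_eq by auto
    define l' where "l' j = (case j of None \<Rightarrow> l | Some i \<Rightarrow> int (e i))" for j
    have "z = to_fract [:\<iota> u:] * mon l'"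
      using mon[of l' e u] by (simp add: z(3) l'_def)
    moreover have "\<forall>k\<in>A \<times> UNIV. 0 \<le> form k l'"
      using z(2) by (auto simp: form_def l'_def add.commute)
    moreover have "to_fract [:\<iota> u:] \<in> U"
      unfolding U_def using z(1) by blast
    ultimately show "z \<in> cone"
      using coneI[of "to_fract [:\<iota> u:]" l'] by blast
  next
    fix z assume "z \<in> cone"
    then obtain v l where "v \<in> U" "z = v * mon l" and cone: "\<forall>k\<in>A \<times> UNIV. 0 \<le> form k l"
      unfolding cone_def by blast
    then obtain u where z: "u dvd 1" "z = to_fract [:\<iota> u:] * mon l"
      unfolding U_def by blast
    \<comment> \<open>The \<open>False\<close> forms make the linear exponents natural numbers; the
      \<open>True\<close> forms are the integrality criterion.\<close>
    have l: "0 \<le> l (Some i)" "0 \<le> l None + l (Some i)" if "i \<in> A" for i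
      using cone[rule_format, of "(i, False)"] cone[rule_format, of "(i, True)"] that
      by (auto simp: form_def)
    have "z = to_fract (smult (\<iota> u * \<iota> \<pi> powi l None) (\<Prod>i\<in>A. lin i ^ nat (l (Some i))))"
      unfolding z(2) using l(1) by (intro mon[symmetric]) simp
    moreover have "\<forall>i\<in>A. 0 \<le> l None + int (nat (l (Some i)))"
      using l by simp
    then have "smult (\<iota> u * \<iota> \<pi> powi l None) (\<Prod>i\<in>A. lin i ^ nat (l (Some i))) \<in> divisors_of_powers \<iota> (\<Prod>i\<in>A. lin i)"
      unfolding divisors_eq using z(1)
      by (intro CollectI exI[of _ u] exI[of _ "l None"] exI[of _ "\<lambda>i. nat (l (Some i))"]) simp
    ultimately show "z \<in> to_fract ` divisors_of_powers \<iota> (\<Prod>i\<in>A. lin i)"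
      by (rule image_eqI)
  qed
qed

end

subsection \<open>Residue class rings\<close>

lemma principal_ideal_eq: "PIdl\<^bsub>ring_of_type_algebra\<^esub> (p::'r::comm_ring_1) = {x. p dvd x}"
  by (auto simp: cgenideal_def ring_of_type_algebra_def dvd_def mult.commute)

lemma residue_class_eq: "residue_class p x = {y. p dvd y - x}"
proof -
  have "y \<in> residue_class p x \<longleftrightarrow> p dvd y - x" for y
    unfolding a_r_coset_def r_coset_def principal_ideal_eq
    by (auto simp: ring_of_type_algebra_def dvd_def) (metis diff_add_cancel)
  then show ?thesis
    by blast
qed

lemma residue_class_eq_iff: "residue_class p x = residue_class p y \<longleftrightarrow> p dvd x - y"
proof
  assume "residue_class p x = residue_class p y"
  moreover have "x \<in> residue_class p x"
    by (simp add: residue_class_eq)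
  ultimately show "p dvd x - y"
    by (simp add: residue_class_eq)
next
  assume *: "p dvd x - y"
  have "p dvd z - x \<longleftrightarrow> p dvd z - y" for z
    using dvd_add_left_iff[OF *, of "z - x"] by simp
  then show "residue_class p x = residue_class p y"
    by (simp add: residue_class_eq)
qed

lemma carrier_residue_ring: "carrier (residue_ring_mod p) = range (residue_class p)"
  by (auto simp: FactRing_def A_RCOSETS_def RCOSETS_def a_r_coset_def ring_of_type_algebra_def)

text \<open>If \<open>p\<close> divided \<open>x\<close>, an inverse of \<open>x\<close> modulo
  \<open>p\<close> would make \<open>p\<close> divide 1.\<close>

lemma residue_class_unit_not_dvd:
  fixes p :: "'r::idom"
  assumes "residue_class p x \<in> Units (residue_ring_mod p)" "\<not> p dvd 1"
  shows "\<not> p dvd x"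
proof
  assume "p dvd x"
  interpret cring "ring_of_type_algebra :: 'r ring"
    by (rule cring_from_type_algebra)
  interpret ideal "PIdl\<^bsub>ring_of_type_algebra\<^esub> p" "ring_of_type_algebra :: 'r ring"
    by (rule cgenideal_ideal) (simp add: ring_of_type_algebra_def)
  obtain Y where Y: "Y \<in> carrier (residue_ring_mod p)"
    "residue_class p x \<otimes>\<^bsub>residue_ring_mod p\<^esub> Y = \<one>\<^bsub>residue_ring_mod p\<^esub>"
    using assms(1) by (auto simp: Units_def)
  obtain y where "Y = residue_class p y"
    using Y(1) carrier_residue_ring by blast
  then have "residue_class p (x * y) = residue_class p 1"
    using Y(2) rcoset_mult_add[of x y] by (simp add: FactRing_def ring_of_type_algebra_def)
  then have "p dvd x * y - 1"
    by (simp only: residue_class_eq_iff)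
  then show False
    using \<open>p dvd x\<close> assms(2) by (metis dvd_diff_commute dvd_diffD dvd_mult2 dvd_diff_right_iff)
qed

subsection \<open>The class group, its prime divisor classes and the Davenport constant\<close>

context linear_product_without_fixed_divisor
begin

lemma principal_weights: "\<exists>z\<in>krull.L. \<forall>i\<in>A. m i = weight i z"
  using weights_realized[of m] by (metis (no_types, lifting))

text \<open>Every exponent vector is principal, so the class group is trivial; each prime is its own
  partner, and the trivial class alone is a minimal zero-sum sequence.\<close>

lemma singleton_conclusion:
  assumes A: "A = {j}"
  shows "v_class_group cone \<cong> product_group ({}::nat set) (\<lambda>_. integer_group) \<and>
    (\<forall>P\<in>min_primes cone. \<exists>Q\<in>min_primes cone. \<exists>c\<in>cone. v_closure cone (P * Q) = c *o cone) \<and>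
    davenport (v_class_group cone) (ideal_class cone ` min_primes cone) \<ge> enat (card A)"
proof (intro conjI)
  show "v_class_group cone \<cong> product_group ({}::nat set) (\<lambda>_. integer_group)"
    by (rule krull.v_class_group_iso[where \<phi> = "\<lambda>_ _. 0"]) (use principal_weights in auto)
  show "\<forall>P\<in>min_primes cone. \<exists>Q\<in>min_primes cone. \<exists>c\<in>cone. v_closure cone (P * Q) = c *o cone"
  proof (rule krull.min_primes_inverse)
    fix i assume i: "i \<in> A"
    \<comment> \<open>With \<open>Q = P\<close> the generator has value 2.\<close>
    obtain z where z: "z \<in> krull.L" "\<forall>k\<in>A. 2 = weight k z"
      using principal_weights[of "\<lambda>_. 2"] by blast
    then have "z \<in> cone"
      using krull.mem_iff[OF z(1)] by (metis zero_le_numeral)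
    then show "\<exists>k\<in>A. \<exists>c\<in>cone. \<forall>j\<in>A. weight j c = (if j = i then 1 else 0) + (if j = k then 1 else 0)"
      using z(2) i A by (intro bexI[of _ i] bexI[of _ z]) auto
  qed
  show "davenport (v_class_group cone) (ideal_class cone ` min_primes cone) \<ge> enat (card A)"
  proof (rule krull.davenport_ge_card)
    show "\<exists>z\<in>krull.L. \<forall>i\<in>A. weight i z = (if i \<in> A then 1 else 0)"
      using principal_weights[of "\<lambda>_. 1"] by force
  qed (use A in auto)
qed

end

context linear_product_with_fixed_divisor
begin

text \<open>The two forms at an index differ by the exponent \<open>d\<close> of
  \<open>\<pi>\<close>, the same for all indices; the \<open>False\<close> coordinates are
  free.\<close>

lemma form_values_iff:
  "(\<exists>l. \<forall>k\<in>A \<times> UNIV. m k = form k l) \<longleftrightarrow> (\<exists>d. \<forall>i\<in>A. m (i, True) - m (i, False) = d)"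
proof
  assume "\<exists>l. \<forall>k\<in>A \<times> UNIV. m k = form k l"
  then show "\<exists>d. \<forall>i\<in>A. m (i, True) - m (i, False) = d"
    by (auto simp: form_def)
next
  assume "\<exists>d. \<forall>i\<in>A. m (i, True) - m (i, False) = d"
  then obtain d where d: "\<And>i. i \<in> A \<Longrightarrow> m (i, True) - m (i, False) = d"
    by blast
  define l where "l j = (case j of None \<Rightarrow> d | Some i \<Rightarrow> m (i, False))" for j
  have "m (i, s) = form (i, s) l" if "i \<in> A" for i s
    using d[OF that] by (cases s) (auto simp: form_def l_def)
  then show "\<exists>l. \<forall>k\<in>A \<times> UNIV. m k = form k l"
    by auto
qed

lemma principal_iff:
  "(\<exists>z\<in>krull.L. \<forall>k\<in>A \<times> UNIV. m k = weight k z) \<longleftrightarrow> (\<exists>d. \<forall>i\<in>A. m (i, True) - m (i, False) = d)"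
proof -
  have "(\<exists>z\<in>krull.L. \<forall>k\<in>A \<times> UNIV. m k = weight k z) \<longleftrightarrow> (\<exists>l. \<forall>k\<in>A \<times> UNIV. m k = form k l)"
  proof
    assume "\<exists>z\<in>krull.L. \<forall>k\<in>A \<times> UNIV. m k = weight k z"
    then obtain z where z: "z \<in> krull.L" "\<forall>k\<in>A \<times> UNIV. m k = weight k z"
      by blast
    then show "\<exists>l. \<forall>k\<in>A \<times> UNIV. m k = form k l"
      using weights_from_exponents[OF z(1)] by auto
  next
    assume "\<exists>l. \<forall>k\<in>A \<times> UNIV. m k = form k l"
    then obtain l where l: "\<forall>k\<in>A \<times> UNIV. m k = form k l"
      by blast
    obtain z where "z \<in> krull.L" "\<forall>k\<in>A \<times> UNIV. weight k z = form k l"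
      using weights_realized by blast
    then show "\<exists>z\<in>krull.L. \<forall>k\<in>A \<times> UNIV. m k = weight k z"
      using l by (intro bexI[of _ z]) auto
  qed
  then show ?thesis
    by (simp only: form_values_iff)
qed

text \<open>By \<open>principal_iff\<close> a vector is principal when its differences between the
  two coordinates agree at all indices. Measuring them against the index \<open>j\<close> leaves
  \<open>J\<close> as free coordinates.\<close>

lemma class_group_iso:
  assumes A: "A = insert j J" "j \<notin> J"
  shows "v_class_group cone \<cong> product_group J (\<lambda>_. integer_group)"
proof (rule krull.v_class_group_iso[where \<phi> = "\<lambda>m i. (m (i, False) - m (i, True)) - (m (j, False) - m (j, True))"])
  show "\<exists>m. \<forall>i\<in>J. (m (i, False) - m (i, True)) - (m (j, False) - m (j, True)) = v i" for v :: "'i \<Rightarrow> int"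
    by (rule exI[of _ "\<lambda>(i, s). if i = j \<or> s then 0 else v i"]) (use A in auto)
  show "(\<forall>i\<in>J. (m (i, False) - m (i, True)) - (m (j, False) - m (j, True)) = 0) \<longleftrightarrow>
    (\<exists>z\<in>krull.L. \<forall>k\<in>A \<times> UNIV. m k = weight k z)" (is "?kernel \<longleftrightarrow> _") for m
    unfolding principal_iff
  proof
    show "\<exists>d. \<forall>i\<in>A. m (i, True) - m (i, False) = d" if ?kernel
      using that by (intro exI[of _ "m (j, True) - m (j, False)"]) (auto simp: A(1))
  qed (auto simp: A(1))
qed (use A in auto)

text \<open>The partner of a prime is the other one at the same index: the vector with 1 at both is
  the value vector of the linear factor.\<close>

lemma primes_inverse:
  "\<forall>P\<in>min_primes cone. \<exists>Q\<in>min_primes cone. \<exists>c\<in>cone. v_closure cone (P * Q) = c *o cone"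
proof (rule krull.min_primes_inverse)
  fix k assume k: "k \<in> A \<times> (UNIV :: bool set)"
  obtain i s where [simp]: "k = (i, s)"
    by (cases k)
  define m where "m k' = (if fst k' = i then 1 else 0 :: int)" for k' :: "'i \<times> bool"
  have "\<exists>z\<in>krull.L. \<forall>k\<in>A \<times> UNIV. m k = weight k z"
    unfolding principal_iff by (auto simp: m_def)
  then obtain z where z: "z \<in> krull.L" "\<And>k. k \<in> A \<times> UNIV \<Longrightarrow> weight k z = m k"
    by metis
  then have "z \<in> cone"
    by (subst krull.mem_iff) (auto simp: m_def)
  moreover have "m k' = (if k' = k then 1 else 0) + (if k' = (i, \<not> s) then 1 else 0)" for k'
    by (cases k') (auto simp: m_def)
  ultimately show "\<exists>k'\<in>A \<times> UNIV. \<exists>c\<in>cone. \<forall>j\<in>A \<times> UNIV.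
      weight j c = (if j = k then 1 else 0) + (if j = k' then 1 else 0)"
    using k z(2) by (intro bexI[of _ "(i, \<not> s)"] bexI[of _ z]) auto
qed

text \<open>The indicator of all \<open>False\<close> primes has constant difference -1: it belongs
  to the product of the linear factors divided by \<open>\<pi>\<close>. A nonempty proper part has
  both differences -1 and 0, so it is not principal.\<close>

lemma davenport_ge:
  assumes "A \<noteq> {}"
  shows "enat (card A) \<le> davenport (v_class_group cone) (ideal_class cone ` min_primes cone)"
proof -
  let ?A = "A \<times> {False}"
  have principal: "(\<exists>z\<in>krull.L. \<forall>k\<in>A \<times> UNIV. weight k z = m k) \<longleftrightarrow>
      (\<exists>d. \<forall>i\<in>A. m (i, True) - m (i, False) = d)" for m
    unfolding principal_iff[symmetric] by (simp only: eq_commute)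
  have "enat (card ?A) \<le> davenport (v_class_group cone) (ideal_class cone ` min_primes cone)"
  proof (rule krull.davenport_ge_card)
    show "\<exists>z\<in>krull.L. \<forall>k\<in>A \<times> UNIV. weight k z = (if k \<in> ?A then 1 else 0)"
      unfolding principal by auto
    show "\<exists>k\<in>A \<times> UNIV. weight k z \<noteq> (if k \<in> B then 1 else 0)"
      if B: "B \<subset> ?A" "B \<noteq> {}" and z: "z \<in> krull.L" for B z
    proof (rule ccontr)
      assume "\<not> ?thesis"
      then have "\<exists>d. \<forall>i\<in>A. (if (i, True) \<in> B then 1 else 0) - (if (i, False) \<in> B then 1 else 0) = (d::int)"
        using z by (subst principal[symmetric]) blast
      then obtain d where d: "\<And>i. i \<in> A \<Longrightarrow> (if (i, True) \<in> B then 1 else 0) - (if (i, False) \<in> B then 1 else 0) = (d::int)"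
        by blast
      obtain i k where "(i, False) \<in> B" "i \<in> A" "(k, False) \<notin> B" "k \<in> A"
        using B by blast
      moreover have "(i', True) \<notin> B" for i'
        using B(1) by blast
      ultimately show False
        using d[of i] d[of k] by simp
    qed
    show "inj_on (\<lambda>k. ideal_class cone (krull.prime_at k)) ?A"
    proof (rule inj_onI)
      fix x y assume xy: "x \<in> ?A" "y \<in> ?A"
        "ideal_class cone (krull.prime_at x) = ideal_class cone (krull.prime_at y)"
      then obtain i k where ik: "x = (i, False)" "y = (k, False)" "i \<in> A" "k \<in> A"
        by auto
      \<comment> \<open>Equal classes give a constant difference, but for distinct \<open>i\<close>
        and \<open>k\<close> it would be -1 at \<open>i\<close> and 1 at \<open>k\<close>.\<close>
      then obtain d where d: "\<And>j. j \<in> A \<Longrightarrow> - (if j = i then 1 else 0) + (if j = k then 1 else 0) = (d::int)"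
        using xy(3) unfolding krull.prime_at_def krull.ideal_class_eq_iff principal_iff by auto
      then have "i = k"
        using d[OF ik(3)] d[OF ik(4)] by (auto split: if_splits)
      then show "x = y"
        by (simp add: ik)
    qed
  qed (use assms in auto)
  then show ?thesis
    by (simp add: card_cartesian_product)
qed

end

section \<open>Reduction to the two locales, for \<open>n = 1\<close> and
  \<open>n \<ge> 2\<close>\<close>

theorem proposition6p5:
  fixes \<iota> :: "'r::{factorial_semiring, idom_divide} \<Rightarrow> 'k::field"
    and \<P> :: "'r set"
    and n :: nat
    and a p :: "nat \<Rightarrow> 'r"
    and H :: "'k poly fract set"
  assumes "quotient_field \<iota>"
    and "atom_representatives \<P>"
    and "n \<ge> 1"
    and "\<forall>i\<in>{1..n}. p i \<in> \<P>"
    and "\<forall>i\<in>{1..n}.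
           p 1 dvd a i - 1 \<and>
           (\<forall>k\<in>{2..n}. residue_class (p k) (a i) \<in> Units (residue_ring_mod (p k))) \<and>
           (i > 1 \<longrightarrow>
              n = card ((\<lambda>j. residue_class (p 1) (p j)) ` {1..n}) \<and>
              n = card (carrier (residue_ring_mod (p 1))) \<and>
              carrier (residue_ring_mod (p 1)) \<prec> carrier (residue_ring_mod (p i)))"
    and "H = to_fract ` divisors_of_powers \<iota> (\<Prod>i=1..n. [:- \<iota> (p i), \<iota> (a i):])"
  shows "v_class_group H \<cong> product_group {1..<n} (\<lambda>_. integer_group) \<and>
         (\<forall>P\<in>min_primes H. \<exists>Q\<in>min_primes H. \<exists>c\<in>H. v_closure H (P * Q) = c *o H) \<and>
         davenport (v_class_group H) (ideal_class H ` min_primes H) \<ge> enat n"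
proof -
  have prime_p: "prime_elem (p i)" if "i \<in> {1..n}" for i
    using assms(2,4) that by (auto simp: atom_representatives_def)
  have prime_p1: "prime_elem (p 1)"
    using prime_p assms(3) by simp
  have a_cong: "p 1 dvd a i - 1" if "i \<in> {1..n}" for i
    using assms(5) that by blast
  have not_dvd_a: "\<not> p 1 dvd a i" if "i \<in> {1..n}" for i
    using a_cong[OF that] prime_p1 by (metis dvd_diff_right_iff prime_elem_not_unit)
  have a_nonzero: "a i \<noteq> 0" if "i \<in> {1..n}" for i
    using not_dvd_a[OF that] by auto
  \<comment> \<open>Modulo \<open>p 1\<close> the leading coefficient \<open>a i\<close> is
    1.\<close>
  have val_cong: "p 1 dvd (a i * c - p i) \<longleftrightarrow> p 1 dvd c - p i" if "i \<in> {1..n}" for i c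
  proof -
    have eq: "a i * c - p i = (a i - 1) * c + (c - p i)"
      by (simp add: algebra_simps)
    show ?thesis
      unfolding eq using a_cong[OF that] by (intro dvd_add_right_iff dvd_mult2)
  qed
  show ?thesis
  proof (cases "n = 1")
    case True
    interpret linear_product \<iota> "{1}" a p
      by unfold_locales (use assms(1,3) a_nonzero in auto)
    interpret linear_product_without_fixed_divisor \<iota> "{1}" a p
    proof
      fix q :: 'r assume q: "prime_elem q"
      show "\<exists>c. \<forall>i\<in>{1}. \<not> q dvd val i c"
      \<comment> \<open>A prime dividing \<open>p 1\<close> is associated with it and so does not
        divide \<open>a 1\<close>, hence \<open>c = 1\<close> works; for all others
        \<open>c = 0\<close> gives the value \<open>- p 1\<close>.\<close>
      proof (cases "q dvd p 1")
        case True
        then have "p 1 dvd q"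
          using irreducibleD'[OF prime_elem_imp_irreducible[OF prime_p1]] q prime_elem_not_unit by blast
        then have "\<not> q dvd a 1"
          using not_dvd_a[of 1] assms(3) by (auto dest: dvd_trans)
        then have "\<not> q dvd val 1 1"
          using True by (simp add: val_def dvd_diff_left_iff)
        then show ?thesis
          by blast
      next
        case False
        then have "\<not> q dvd val 1 0"
          by (simp add: val_def)
        then show ?thesis
          by blast
      qed
    qed
    have "H = cone"
      unfolding assms(6) to_fract_divisors[symmetric] by (simp add: True lin_def)
    then show ?thesis
      using singleton_conclusion[of 1] True by simp
  next
    case False
    then have n: "2 \<le> n"
      using assms(3) by simp
    \<comment> \<open>The conditions guarded by \<open>i > 1\<close> become available because 2 is
      an index.\<close>
    have card_image: "card ((\<lambda>j. residue_class (p 1) (p j)) ` {1..n}) = n"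
      and card_carrier: "card (carrier (residue_ring_mod (p 1))) = n"
      and lesspoll: "\<And>i. i \<in> {2..n} \<Longrightarrow> carrier (residue_ring_mod (p 1)) \<prec> carrier (residue_ring_mod (p i))"
      using assms(5) n by auto
    have finite_carrier: "finite (carrier (residue_ring_mod (p 1)))"
      using card_carrier n by (intro card_ge_0_finite) simp
    have inj: "inj_on (\<lambda>j. residue_class (p 1) (p j)) {1..n}"
      using card_image by (intro eq_card_imp_inj_on) simp_all
    have distinct: "j = k" if "p 1 dvd p j - p k" "j \<in> {1..n}" "k \<in> {1..n}" for j k
      by (rule inj_onD[OF inj]) (use that residue_class_eq_iff in blast)+
    \<comment> \<open>The \<open>p j\<close> have as many distinct classes as the residue ring has
      elements, so they represent every class.\<close>
    have "(\<lambda>j. residue_class (p 1) (p j)) ` {1..n} = carrier (residue_ring_mod (p 1))"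
      using card_image card_carrier finite_carrier
      by (intro card_subset_eq) (auto simp: carrier_residue_ring)
    then have covers: "\<exists>j\<in>{1..n}. p 1 dvd c - p j" for c
      unfolding carrier_residue_ring residue_class_eq_iff[symmetric] by blast
    interpret linear_product \<iota> "{1..n}" a p
    proof
      fix i j assume ij: "i \<in> {1..n}" "j \<in> {1..n}" "i \<noteq> j"
      show "a i * p j \<noteq> a j * p i"
      proof
        assume eq: "a i * p j = a j * p i"
        \<comment> \<open>Equal roots would make \<open>p i\<close> and \<open>p j\<close> congruent
          modulo \<open>p 1\<close>, as both leading coefficients are 1 there.\<close>
        have "p j - p i = (a j - 1) * p i - (a i - 1) * p j"
          using eq by (simp add: algebra_simps)
        then have "p 1 dvd p j - p i"
          using a_cong ij by (simp add: dvd_diff)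
        then show False
          using distinct ij by blast
      qed
    qed (use assms(1) a_nonzero in auto)
    have val_dvd: "p 1 dvd val i c \<longleftrightarrow> p 1 dvd c - p i" if "i \<in> {1..n}" for i c
      using val_cong[OF that] by (simp add: val_def)
    interpret linear_product_with_fixed_divisor \<iota> "{1..n}" a p "p 1"
    proof
      show "prime_elem (p 1)"
        by (rule prime_p1)
      show "\<exists>i\<in>{1..n}. p 1 dvd val i c" for c
        using covers val_dvd by blast
      show "\<exists>c. multiplicity (p 1) (val i c) = 1 \<and> (\<forall>k\<in>{1..n} - {i}. \<not> p 1 dvd val k c)"
        if i: "i \<in> {1..n}" for i
      proof -
        have others: "\<forall>k\<in>{1..n} - {i}. \<not> p 1 dvd val k c" if "p 1 dvd c - p i" for c
        proof (intro ballI notI)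
          fix k assume k: "k \<in> {1..n} - {i}" "p 1 dvd val k c"
          then have "p 1 dvd c - p k"
            using val_dvd by blast
          then have "p 1 dvd (c - p i) - (c - p k)"
            by (rule dvd_diff[OF that])
          then have "p 1 dvd p k - p i"
            by simp
          then show False
            using distinct k i by blast
        qed
        have mult_1: "multiplicity (p 1) x = 1" if "p 1 dvd x" "\<not> p 1 ^ 2 dvd x" for x
          using that by (intro multiplicity_eqI) (simp_all add: numeral_2_eq_2)
        \<comment> \<open>Passing from \<open>p i\<close> to \<open>p i + p 1\<close> changes the
          value by \<open>a i * p 1\<close>, which \<open>p 1\<close> divides exactly once; so at
          one of these points the value is not divisible by the square.\<close>
        have "\<exists>c. p 1 dvd c - p i \<and> \<not> p 1 ^ 2 dvd val i c"
        proof (cases "p 1 ^ 2 dvd val i (p i)")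
          case True
          have "val i (p i + p 1) = val i (p i) + a i * p 1"
            by (simp add: val_def algebra_simps)
          moreover have "\<not> p 1 ^ 2 dvd a i * p 1"
            using not_dvd_a[OF i] prime_p1 by (auto simp: power2_eq_square)
          ultimately have "\<not> p 1 ^ 2 dvd val i (p i + p 1)"
            using True by (simp add: dvd_add_right_iff)
          then show ?thesis
            by (intro exI[of _ "p i + p 1"]) simp
        next
          case False
          then show ?thesis
            by (intro exI[of _ "p i"]) simp
        qed
        then obtain c where "p 1 dvd c - p i" "\<not> p 1 ^ 2 dvd val i c"
          by blast
        then show ?thesis
          using others mult_1 val_dvd[OF i] by blast
      qed
      fix q :: 'r assume q: "prime_elem q" "\<not> p 1 dvd q"
      show "\<exists>c. \<forall>i\<in>{1..n}. \<not> q dvd val i c"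
      \<comment> \<open>If \<open>q\<close> divides no \<open>p k\<close>, the point 0 works.
        Otherwise \<open>q\<close> is associated with some \<open>p k\<close> with
        \<open>k \<ge> 2\<close>, and roots are counted in its residue ring.\<close>
      proof (cases "\<exists>k\<in>{1..n}. q dvd p k")
        case False
        then show ?thesis
          by (intro exI[of _ 0]) (simp add: val_def)
      next
        case True
        then obtain k where k: "k \<in> {1..n}" "q dvd p k"
          by blast
        then have pk: "p k dvd q"
          using irreducibleD'[OF prime_elem_imp_irreducible[OF prime_p]] q prime_elem_not_unit by blast
        have "k \<noteq> 1"
          using pk q(2) by auto
        then have k2: "k \<in> {2..n}"
          using k by simp
        have not_dvd: "\<not> p k dvd a i" if "i \<in> {1..n}" for i
          using assms(5) that k2 prime_p[OF k(1)] prime_elem_not_unit residue_class_unit_not_dvd by blast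
        show ?thesis
        \<comment> \<open>If every point were a root of some factor modulo \<open>p k\<close>, let
          \<open>f\<close> select such a factor. Its leading coefficient is not divisible by
          \<open>p k\<close>, so the factor determines the root modulo \<open>p k\<close>. The
          residue ring of \<open>p k\<close> would embed into \<open>{1..n}\<close>, which is
          equipotent to the strictly smaller residue ring of \<open>p 1\<close>.\<close>
        proof (rule ccontr)
          assume "\<not> ?thesis"
          then have "\<forall>c. \<exists>i\<in>{1..n}. p k dvd val i c"
            using pk by (meson dvd_trans)
          then obtain f where f: "\<And>c. f c \<in> {1..n}" "\<And>c. p k dvd val (f c) c"
            by metis
          define rep where "rep = inv_into UNIV (residue_class (p k))"
          have rep: "residue_class (p k) (rep Y) = Y" if "Y \<in> carrier (residue_ring_mod (p k))" for Y
            using that unfolding rep_def carrier_residue_ring by (rule f_inv_into_f)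
          have "inj_on (f \<circ> rep) (carrier (residue_ring_mod (p k)))"
          proof (rule inj_onI)
            fix Y Z assume YZ: "Y \<in> carrier (residue_ring_mod (p k))" "Z \<in> carrier (residue_ring_mod (p k))"
              "(f \<circ> rep) Y = (f \<circ> rep) Z"
            define y z where "y = rep Y" and "z = rep Z"
            have "f y = f z"
              using YZ(3) by (simp add: y_def z_def)
            then have "p k dvd val (f y) y - val (f y) z"
              using f(2)[of y] f(2)[of z] by (simp add: dvd_diff)
            then have "p k dvd a (f y) * (y - z)"
              by (simp add: val_def algebra_simps)
            then have "p k dvd y - z"
              using not_dvd[OF f(1)] prime_p[OF k(1)] prime_elem_dvd_mult_iff by blast
            then show "Y = Z"
              using rep[OF YZ(1)] rep[OF YZ(2)] residue_class_eq_iff[of "p k" y z] by (simp add: y_def z_def)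
          qed
          moreover have "(f \<circ> rep) ` carrier (residue_ring_mod (p k)) \<subseteq> {1..n}"
            using f(1) by (simp add: image_subset_iff)
          ultimately have "carrier (residue_ring_mod (p k)) \<lesssim> {1..n}"
            unfolding lepoll_def by blast
          also have "{1..n} \<approx> carrier (residue_ring_mod (p 1))"
            using finite_carrier card_carrier by (simp add: eqpoll_iff_card)
          finally show False
            using lesspoll[OF k2] by (auto simp: lesspoll_def dest: lepoll_antisym)
        qed
      qed
    qed
    have H: "H = cone"
      unfolding assms(6) to_fract_divisors[symmetric] by (simp add: lin_def)
    \<comment> \<open>The reference index for \<open>class_group_iso\<close> is \<open>n\<close>,
      leaving \<open>n - 1\<close> free coordinates.\<close>
    have "{1..n} = insert n {1..<n}"
      using n by auto
    then have "v_class_group cone \<cong> product_group {1..<n} (\<lambda>_. integer_group)"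
      by (rule class_group_iso) simp
    then show ?thesis
      unfolding H using primes_inverse davenport_ge n by simp
  qed
qed

end
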